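(* Let $\mathbb{X}$ be a finite-dimensional Euclidean space, let $f:\mathbb{X}\to\mathbb{R}$ be a twice continuously differentiable convex function, let $g:\mathbb{X}\to\mathbb{R}\cup\{+\infty\}$ be a proper convex polyhedral function, and put $\varphi:=f+g$. Suppose that $\bar x$ is a tilt stable minimizer of $\varphi$, i.e., $-\nabla f(\bar x)\in\partial g(\bar x)$ and $\operatorname{Ker}\nabla^2 f(\bar x)\cap \operatorname{par}\partial g^*(-\nabla f(\bar x))=\{0\}$, and that $\nabla^2 f$ is Lipschitz continuous around $\bar x$. Let $\alpha>0$. Then there exists $\varepsilon>0$ such that for each $x_0$ with $\|x_0-\bar x\|\le\varepsilon$, the ISTA-Newton method with effective subspaces (described in the context) with parameter $\alpha$ produces a sequence $\{x_k\}$ converging quadratically to $\bar x$.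
   Context: Notation. $\partial g$ is the convex subdifferential of $g$, and $g^*(v)=\sup_{x}\{\langle v,x\rangle-g(x)\}$ is the Legendre–Fenchel conjugate. A proper function $g$ is convex polyhedral if its epigraph is the intersection of finitely many closed half-spaces in $\mathbb{X}\times\mathbb{R}$. For a nonempty convex set $C$, $\operatorname{par}C:=\operatorname{span}(C-x)$ for any $x\in C$. The proximal operator is $\operatorname{prox}_{\alpha g}(x):=\operatorname{argmin}_{y}\{g(y)+\frac1{2\alpha}\|y-x\|^2\}$. Tilt stability. A point $\bar x\in\operatorname{dom}\varphi$ is a tilt stable minimizer of a lower semicontinuous convex function $\varphi$ if there is $\gamma>0$ such that $M_\gamma(v):=\operatorname{argmin}\{\varphi(x)-\langle v,x\rangle\mid \|x-\bar x\|\le\gamma\}$ is single-valued and Lipschitz continuous on some neighborhood of $0\in\mathbb{X}$ with $M_\gamma(0)=\{\bar x\}$. For $\varphi=f+g$ as here this is known to be equivalent to the two conditions given after "i.e." in the claim. ISTA-Newton method with effective subspaces. Input: $x_0\in\mathbb{X}$, $\alpha>0$. For $k=0,1,2,\dots$: (1) $y_k:=\operatorname{prox}_{\alpha g}(x_k-\alpha\nabla f(x_k))$; (2) $z_k:=\frac{x_k-y_k}{\alpha}-\nabla f(x_k)$; (3) $L_k:=\operatorname{par}\partial g^*(z_k)$, and $d_k$ is an optimal solution of $\min_{d\in L_k}\frac12\langle\nabla^2 f(y_k)d,d\rangle-\langle z_k+\nabla f(y_k),d\rangle$; (4) $x_{k+1}=y_k-d_k$. Quadratic convergence of $\{x_k\}$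 to $\bar x$ means that $x_k\to\bar x$ and there is a constant $C>0$ (independent of $x_0$) such that $\|x_{k+1}-\bar x\|\le C\|x_k-\bar x\|^2$ for all $k$. *)

theory Defs
  imports "HOL-Analysis.Analysis"
begin

definition proper_fun :: "('a \<Rightarrow> ereal) \<Rightarrow> bool" where
  "proper_fun g \<longleftrightarrow> (\<forall>x. g x \<noteq> -\<infinity>) \<and> (\<exists>x. g x < \<infinity>)"

(* The library constant epigraph is for real-valued functions only. *)
definition ereal_epigraph :: "('a \<Rightarrow> ereal) \<Rightarrow> ('a \<times> real) set" where
  "ereal_epigraph g = {(x, r). g x \<le> ereal r}"

definition convex_polyhedral :: "('a::euclidean_space \<Rightarrow> ereal) \<Rightarrow> bool" where
  "convex_polyhedral g \<longleftrightarrow> polyhedron (ereal_epigraph g)"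

(* Empty at points where g is not finite. *)
definition subdifferential :: "('a::real_inner \<Rightarrow> ereal) \<Rightarrow> 'a \<Rightarrow> 'a set" where
  "subdifferential g x =
     {v. \<bar>g x\<bar> \<noteq> \<infinity> \<and> (\<forall>y. g x + ereal (v \<bullet> (y - x)) \<le> g y)}"

definition fenchel_conjugate :: "('a::real_inner \<Rightarrow> ereal) \<Rightarrow> 'a \<Rightarrow> ereal" where
  "fenchel_conjugate g v = (SUP x. ereal (v \<bullet> x) - g x)"

(* For nonempty C this is span (C - x) for any base point x in C; see parallel_span_eq. *)
definition parallel_span :: "'a::real_vector set \<Rightarrow> 'a set" where
  "parallel_span C = span {y - x | x y. x \<in> C \<and> y \<in> C}"

lemma parallel_span_eq:
  assumes "x \<in> C"
  shows "parallel_span C = span ((\<lambda>y. y - x) ` C)"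
proof
  have "y - z \<in> span ((\<lambda>y. y - x) ` C)" if "y \<in> C" "z \<in> C" for y z
  proof -
    have "(y - x) - (z - x) \<in> span ((\<lambda>y. y - x) ` C)"
      using that by (intro span_diff span_base) auto
    then show ?thesis by simp
  qed
  then show "parallel_span C \<subseteq> span ((\<lambda>y. y - x) ` C)"
    unfolding parallel_span_def by (intro span_minimal) auto
  show "span ((\<lambda>y. y - x) ` C) \<subseteq> parallel_span C"
    unfolding parallel_span_def using assms by (intro span_mono) auto
qed

(* The proximal operator as a set of minimizers (a singleton for proper convex
   lower semicontinuous g and a > 0). *)
definition prox :: "real \<Rightarrow> ('a::real_normed_vector \<Rightarrow> ereal) \<Rightarrow> 'a \<Rightarrow> 'a set" where
  "prox a g x = {y. is_arg_min (\<lambda>y. g y + ereal (1 / (2 * a) * (norm (y - x))\<^sup>2)) (\<lambda>_. True) y}"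

(* The map M_gamma of the definition of tilt stability. *)
definition tilt_argmin ::
    "('a::real_inner \<Rightarrow> ereal) \<Rightarrow> 'a \<Rightarrow> real \<Rightarrow> 'a \<Rightarrow> 'a set" where
  "tilt_argmin \<phi> xbar \<gamma> v =
     {x. is_arg_min (\<lambda>x. \<phi> x - ereal (v \<bullet> x)) (\<lambda>x. norm (x - xbar) \<le> \<gamma>) x}"

definition tilt_stable_minimizer :: "('a::real_inner \<Rightarrow> ereal) \<Rightarrow> 'a \<Rightarrow> bool" where
  "tilt_stable_minimizer \<phi> xbar \<longleftrightarrow>
     \<phi> xbar < \<infinity> \<and>
     (\<exists>\<gamma>>0. tilt_argmin \<phi> xbar \<gamma> 0 = {xbar} \<and>
        (\<exists>U m L. open U \<and> 0 \<in> U \<and>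
           (\<forall>v\<in>U. tilt_argmin \<phi> xbar \<gamma> v = {m v}) \<and> L-lipschitz_on U m))"

(* One iteration x_k = x, x_{k+1} = x'. The arguments f' and f'' are the gradient and
   the Hessian of f; the step depends on f only through them. *)
definition ista_newton_step ::
    "real \<Rightarrow> ('a \<Rightarrow> 'a) \<Rightarrow> ('a \<Rightarrow> 'a \<Rightarrow>\<^sub>L 'a) \<Rightarrow> ('a::real_inner \<Rightarrow> ereal) \<Rightarrow> 'a \<Rightarrow> 'a \<Rightarrow> bool" where
  "ista_newton_step a f' f'' g x x' \<longleftrightarrow>
     (\<exists>y z d. y \<in> prox a g (x - a *\<^sub>R f' x) \<and>
        z = (1 / a) *\<^sub>R (x - y) - f' x \<and>
        is_arg_min (\<lambda>d. 1 / 2 * (blinfun_apply (f'' y) d \<bullet> d) - (z + f' y) \<bullet> d)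
          (\<lambda>d. d \<in> parallel_span (subdifferential (fenchel_conjugate g) z)) d \<and>
        x' = y - d)"

definition ista_newton_sequence ::
    "real \<Rightarrow> ('a \<Rightarrow> 'a) \<Rightarrow> ('a \<Rightarrow> 'a \<Rightarrow>\<^sub>L 'a) \<Rightarrow> ('a::real_inner \<Rightarrow> ereal) \<Rightarrow> 'a \<Rightarrow> (nat \<Rightarrow> 'a) \<Rightarrow> bool" where
  "ista_newton_sequence a f' f'' g x0 x \<longleftrightarrow>
     x 0 = x0 \<and> (\<forall>k. ista_newton_step a f' f'' g (x k) (x (Suc k)))"

definition quadratically_convergent ::
    "real \<Rightarrow> (nat \<Rightarrow> 'a::real_normed_vector) \<Rightarrow> 'a \<Rightarrow> bool" where
  "quadratically_convergent C x xbar \<longleftrightarrow>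
     x \<longlonglongrightarrow> xbar \<and> (\<forall>k. norm (x (Suc k) - xbar) \<le> C * (norm (x k - xbar))\<^sup>2)"

end

theory Submission
  imports Defs
begin

text \<open>
  Write \<open>v = - f' xbar\<close> and, for a slope \<open>z\<close>, let \<open>S z = {x. z \<in> subdifferential g x}\<close>. This is the
  subdifferential of the conjugate of \<open>g\<close> at \<open>z\<close> (\<open>subdifferential_fenchel_conjugate\<close>). Let \<open>L z\<close> be the subspace
  parallel to \<open>S z\<close>.

  Since the epigraph of \<open>g\<close> is a polyhedron, there are only finitely many different sets \<open>S z\<close>
  (\<open>finite_subdifferential_inverse\<close>). Consequently, subgradients of \<open>g\<close> at points near \<open>xbar\<close> are
  subgradients at \<open>xbar\<close>, and \<open>S z \<subseteq> S v\<close> for \<open>z\<close> near \<open>v\<close>. The proximal step depends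
  Lipschitz continuously on \<open>x\<close>, so for \<open>x\<close> near \<open>xbar\<close> both inclusions apply to \<open>y\<close> and to
  \<open>z \<in> subdifferential g y\<close>. They yield \<open>y - xbar \<in> L z \<subseteq> L v\<close>, and \<open>z - v\<close> is orthogonal to \<open>L z\<close>: the
  proximal step has identified a subspace on which \<open>g\<close> contributes nothing to the error.

  Tilt stability makes the Hessian at \<open>xbar\<close> injective on \<open>L v\<close>, with a bound
  (\<open>tilt_stable_imp_hessian_bound\<close>). Because the Hessian is symmetric and positive semidefinite, it is
  coercive on \<open>L v\<close>, and by continuity the Hessians \<open>f'' y\<close> at nearby points are uniformly coercive there. So
  the quadratic subproblem on \<open>L z\<close> has a solution \<open>d\<close>, and its stationarity condition says that
  \<open>f'' y d - (f' y - f' xbar)\<close> is orthogonal to \<open>L z\<close>. With \<open>e = y - xbar\<close>, the new error \<open>e - d\<close> lies in \<open>L z\<close>, and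
  \<open>f'' y (e - d)\<close> differs from \<open>f'' y e - (f' y - f' xbar)\<close> by a vector orthogonal to \<open>L z\<close>. The vector
  \<open>f'' y e - (f' y - f' xbar)\<close> is \<open>O((norm e)\<^sup>2)\<close> by Lipschitz continuity of the Hessian, as in
  Newton's method for smooth equations, and coercivity transfers this bound to \<open>e - d\<close>.
\<close>

section \<open>Subgradients and conjugates of extended-real-valued functions\<close>

text \<open>Quantifying over the points \<open>(y, s)\<close> of the epigraph instead of the values \<open>g y\<close> avoids most of the
  extended-real arithmetic below.\<close>

lemma mem_subdifferential_iff:
  "v \<in> subdifferential g x \<longleftrightarrow>
     (\<exists>r. g x = ereal r \<and> (\<forall>y s. g y \<le> ereal s \<longrightarrow> r + v \<bullet> (y - x) \<le> s))"
proof
  assume v: "v \<in> subdifferential g x"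
  then obtain r where r: "g x = ereal r"
    by (cases "g x") (auto simp: subdifferential_def)
  have "r + v \<bullet> (y - x) \<le> s" if "g y \<le> ereal s" for y s
  proof -
    have "ereal (r + v \<bullet> (y - x)) \<le> g y"
      using v r by (auto simp: subdifferential_def)
    also note that
    finally show ?thesis by simp
  qed
  then show "\<exists>r. g x = ereal r \<and> (\<forall>y s. g y \<le> ereal s \<longrightarrow> r + v \<bullet> (y - x) \<le> s)"
    using r by blast
next
  assume "\<exists>r. g x = ereal r \<and> (\<forall>y s. g y \<le> ereal s \<longrightarrow> r + v \<bullet> (y - x) \<le> s)"
  then obtain r where r: "g x = ereal r"
    and le: "\<And>y s. g y \<le> ereal s \<Longrightarrow> r + v \<bullet> (y - x) \<le> s" by blast
  have "g x + ereal (v \<bullet> (y - x)) \<le> g y" for y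
    unfolding r by (rule ereal_le_real) (use le in auto)
  then show "v \<in> subdifferential g x"
    using r by (auto simp: subdifferential_def)
qed

lemma mem_ereal_epigraph [simp]: "(x, r) \<in> ereal_epigraph g \<longleftrightarrow> g x \<le> ereal r"
  by (simp add: ereal_epigraph_def)

lemma convex_epigraphD:
  assumes "convex (ereal_epigraph g)" "g x \<le> ereal r" "g y \<le> ereal s" "0 \<le> t" "t \<le> 1"
  shows "g (x + t *\<^sub>R (y - x)) \<le> ereal (r + t * (s - r))"
proof -
  have "(1 - t) *\<^sub>R (x, r) + t *\<^sub>R (y, s) \<in> ereal_epigraph g"
    using assms by (intro convexD_alt) auto
  then show ?thesis by (simp add: algebra_simps)
qed

lemma subdifferential_monotone:
  assumes "v \<in> subdifferential g x" "w \<in> subdifferential g y"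
  shows "0 \<le> (v - w) \<bullet> (x - y)"
proof -
  obtain r s where "g x = ereal r" "r + v \<bullet> (y - x) \<le> s" "g y = ereal s" "s + w \<bullet> (x - y) \<le> r"
    using assms unfolding mem_subdifferential_iff by (metis order_refl)
  then show ?thesis by (simp add: inner_diff_left inner_diff_right)
qed

lemma fenchel_conjugate_le:
  assumes "\<And>x r. g x \<le> ereal r \<Longrightarrow> v \<bullet> x - r \<le> b"
  shows "fenchel_conjugate g v \<le> ereal b"
  unfolding fenchel_conjugate_def
proof (rule SUP_least)
  fix x
  show "ereal (v \<bullet> x) - g x \<le> ereal b"
  proof (cases "g x")
    case (real r)
    then show ?thesis using assms[of x r] by simp
  next
    case MInf
    then have "v \<bullet> x - (v \<bullet> x - b - 1) \<le> b" by (intro assms) auto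
    then show ?thesis by simp
  qed simp
qed

lemma fenchel_conjugate_ge:
  assumes "g x \<le> ereal r"
  shows "ereal (v \<bullet> x - r) \<le> fenchel_conjugate g v"
proof -
  have "ereal (v \<bullet> x - r) \<le> ereal (v \<bullet> x) - g x"
    using assms by (cases "g x") auto
  also have "\<dots> \<le> fenchel_conjugate g v"
    unfolding fenchel_conjugate_def by (rule SUP_upper) simp
  finally show ?thesis .
qed

lemma fenchel_conjugate_eqI:
  assumes "g x = ereal r" "v \<in> subdifferential g x"
  shows "fenchel_conjugate g v = ereal (v \<bullet> x - r)"
proof (rule antisym)
  show "fenchel_conjugate g v \<le> ereal (v \<bullet> x - r)"
    using assms by (intro fenchel_conjugate_le) (force simp: mem_subdifferential_iff inner_diff_right)
qed (use assms in \<open>auto intro: fenchel_conjugate_ge\<close>)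

text \<open>The subdifferential of the conjugate is the inverse of the subdifferential. The nontrivial
  inclusion is a separation argument: if \<open>x\<close> is a subgradient of the conjugate at \<open>z\<close> and
  \<open>c\<close> is the conjugate value there, then \<open>(x, z \<bullet> x - c)\<close> must lie in the epigraph of \<open>g\<close>, since a
  hyperplane that strictly separates it from the epigraph contradicts the subgradient inequality at
  another point: the slope of the hyperplane if it is not vertical, and a translate of \<open>z\<close>
  along its normal if it is vertical.\<close>

lemma subdifferential_fenchel_conjugate:
  fixes g :: "'a::euclidean_space \<Rightarrow> ereal"
  assumes proper: "proper_fun g"
    and conv: "convex (ereal_epigraph g)" and clos: "closed (ereal_epigraph g)"
  shows "subdifferential (fenchel_conjugate g) z = {x. z \<in> subdifferential g x}"
proof safe
  fix x assume z: "z \<in> subdifferential g x"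
  then obtain r where r: "g x = ereal r" by (auto simp: mem_subdifferential_iff)
  have "z \<bullet> x - r + x \<bullet> (w - z) \<le> s" if "fenchel_conjugate g w \<le> ereal s" for w s
  proof -
    have "ereal (w \<bullet> x - r) \<le> ereal s"
      using fenchel_conjugate_ge[of g x r w] r that by (metis order_refl order_trans)
    then show ?thesis by (simp add: inner_diff_right inner_commute)
  qed
  then show "x \<in> subdifferential (fenchel_conjugate g) z"
    using fenchel_conjugate_eqI[OF r z] by (auto simp: mem_subdifferential_iff)
next
  fix x assume "x \<in> subdifferential (fenchel_conjugate g) z"
  then obtain c where c: "fenchel_conjugate g z = ereal c"
    and le: "\<And>w s. fenchel_conjugate g w \<le> ereal s \<Longrightarrow> c + x \<bullet> (w - z) \<le> s"
    by (auto simp: mem_subdifferential_iff)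
  have young: "z \<bullet> u - s \<le> c" if "g u \<le> ereal s" for u s
    using fenchel_conjugate_ge[of g u s z] that c by simp
  have epi: "(x, z \<bullet> x - c) \<in> ereal_epigraph g"
  proof (rule ccontr)
    assume "(x, z \<bullet> x - c) \<notin> ereal_epigraph g"
    from separating_hyperplane_closed_point[OF conv clos this]
    obtain p b where p: "p \<bullet> (x, z \<bullet> x - c) < b" and q: "\<And>u. u \<in> ereal_epigraph g \<Longrightarrow> b < p \<bullet> u"
      by blast
    obtain a \<beta> where ab: "p = (a, \<beta>)" by fastforce
    have p: "a \<bullet> x + \<beta> * (z \<bullet> x - c) < b" using p ab by simp
    have q: "b < a \<bullet> u + \<beta> * s" if "g u \<le> ereal s" for u s
      using q[of "(u, s)"] that ab by simp
    obtain u0 s0 where u0: "g u0 = ereal s0"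
      using proper by (metis ereal_infty_less(1) proper_fun_def ereal_cases)
    have "\<beta> \<ge> 0"
    proof (rule ccontr)
      assume neg: "\<not> \<beta> \<ge> 0"
      define s where "s = max s0 ((b - a \<bullet> u0) / \<beta>)"
      have "b < a \<bullet> u0 + \<beta> * s" by (rule q) (simp add: u0 s_def)
      moreover have "\<beta> * s \<le> \<beta> * ((b - a \<bullet> u0) / \<beta>)"
        using neg by (intro mult_left_mono_neg) (auto simp: s_def)
      ultimately show False using neg by simp
    qed
    then consider "\<beta> > 0" | "\<beta> = 0" by linarith
    then show False
    proof cases
      case 1
      have "fenchel_conjugate g (- a /\<^sub>R \<beta>) \<le> ereal (- b / \<beta>)"
      proof (rule fenchel_conjugate_le)
        fix u s assume "g u \<le> ereal s"
        from q[OF this] show "(- a /\<^sub>R \<beta>) \<bullet> u - s \<le> - b / \<beta>"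
          using 1 by (simp add: divide_simps) (simp add: algebra_simps)
      qed
      from le[OF this] have "c - a \<bullet> x / \<beta> - z \<bullet> x \<le> - b / \<beta>"
        by (simp add: inner_diff_right inner_commute divide_inverse mult.commute)
      then have "b / \<beta> \<le> a \<bullet> x / \<beta> + (z \<bullet> x - c)" by simp
      then have "\<beta> * (b / \<beta>) \<le> \<beta> * (a \<bullet> x / \<beta> + (z \<bullet> x - c))" using 1 by (intro mult_left_mono) auto
      with p 1 show False by (simp add: distrib_left)
    next
      case 2
      have "fenchel_conjugate g (z - a) \<le> ereal (c - b)"
      proof (rule fenchel_conjugate_le)
        fix u s assume "g u \<le> ereal s"
        from q[OF this] young[OF this] show "(z - a) \<bullet> u - s \<le> c - b"
          using 2 by (simp add: inner_diff_left)
      qed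
      from le[OF this] show False using p 2 by (simp add: inner_commute)
    qed
  qed
  then obtain r where r: "g x = ereal r"
    using proper by (cases "g x") (auto simp: proper_fun_def)
  have "r = z \<bullet> x - c" using young[of x r] r epi by simp
  then show "z \<in> subdifferential g x"
    using r young by (force simp: mem_subdifferential_iff inner_diff_right)
qed

section \<open>The inverse subdifferential of a polyhedral function\<close>

text \<open>The points at which \<open>z\<close> is a subgradient are those at which \<open>g\<close> meets one fixed affine
  minorant of slope \<open>z\<close>.\<close>

lemma subdifferential_inverse_eq_sublevel:
  assumes "g x0 = ereal r0" "z \<in> subdifferential g x0"
  shows "z \<in> subdifferential g x \<longleftrightarrow> g x \<le> ereal (r0 + z \<bullet> (x - x0))"
proof
  assume z: "z \<in> subdifferential g x"
  then obtain r where "g x = ereal r" "r + z \<bullet> (x0 - x) \<le> r0"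
    using assms by (auto simp: mem_subdifferential_iff)
  then show "g x \<le> ereal (r0 + z \<bullet> (x - x0))" by (simp add: inner_diff_right)
next
  assume le: "g x \<le> ereal (r0 + z \<bullet> (x - x0))"
  have low: "r0 + z \<bullet> (y - x0) \<le> s" if "g y \<le> ereal s" for y s
    using assms that by (auto simp: mem_subdifferential_iff)
  have "ereal (r0 + z \<bullet> (x - x0)) \<le> g x"
    by (rule ereal_le_real) (use low in auto)
  with le have "g x = ereal (r0 + z \<bullet> (x - x0))" by simp
  then show "z \<in> subdifferential g x"
    using low by (force simp: mem_subdifferential_iff inner_diff_right)
qed

lemma closed_subdifferential_inverse:
  fixes g :: "'a::euclidean_space \<Rightarrow> ereal"
  assumes "closed (ereal_epigraph g)"
  shows "closed {x. z \<in> subdifferential g x}"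
proof (cases "{x. z \<in> subdifferential g x} = {}")
  case False
  then obtain x0 r0 where x0: "g x0 = ereal r0" "z \<in> subdifferential g x0"
    by (auto simp: mem_subdifferential_iff)
  have "{x. z \<in> subdifferential g x} = (\<lambda>x. (x, r0 + z \<bullet> (x - x0))) -` ereal_epigraph g"
    by (simp add: vimage_def subdifferential_inverse_eq_sublevel[OF x0])
  moreover have "closed \<dots>"
    by (rule closed_vimage[OF assms]) (intro continuous_intros)
  ultimately show ?thesis by simp
qed simp

lemma convex_subdifferential_inverse:
  assumes "convex (ereal_epigraph g)"
  shows "convex {x. z \<in> subdifferential g x}"
proof (rule convexI)
  fix x y and u v :: real
  assume x: "x \<in> {x. z \<in> subdifferential g x}" and y: "y \<in> {x. z \<in> subdifferential g x}"
    and uv: "0 \<le> u" "0 \<le> v" "u + v = 1"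
  obtain r where r: "g x = ereal r" using x by (auto simp: mem_subdifferential_iff)
  have z: "z \<in> subdifferential g x" using x by simp
  have "g (x + v *\<^sub>R (y - x)) \<le> ereal (r + v * (r + z \<bullet> (y - x) - r))"
    using uv y r subdifferential_inverse_eq_sublevel[OF r z, of y]
    by (intro convex_epigraphD[OF assms]) auto
  then have "g (x + v *\<^sub>R (y - x)) \<le> ereal (r + z \<bullet> (x + v *\<^sub>R (y - x) - x))" by simp
  moreover have u: "u = 1 - v" using uv by simp
  have "u *\<^sub>R x + v *\<^sub>R y = x + v *\<^sub>R (y - x)" unfolding u by (simp add: algebra_simps)
  ultimately show "u *\<^sub>R x + v *\<^sub>R y \<in> {x. z \<in> subdifferential g x}"
    using subdifferential_inverse_eq_sublevel[OF r z] by simp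
qed

text \<open>Each nonempty set \<open>{x. z \<in> subdifferential g x}\<close> is the projection of a face of
  the epigraph, and a polyhedron has finitely many faces. This is the only consequence of polyhedrality that
  the argument uses, besides closedness and convexity of the epigraph.\<close>

lemma finite_subdifferential_inverse:
  fixes g :: "'a::euclidean_space \<Rightarrow> ereal"
  assumes poly: "convex_polyhedral g"
  shows "finite (range (\<lambda>z. {x. z \<in> subdifferential g x}))"
proof (rule finite_subset)
  let ?E = "ereal_epigraph g"
  have E: "polyhedron ?E" using poly by (simp add: convex_polyhedral_def)
  show "finite (insert {} ((`) fst ` {F. F face_of ?E}))"
    using finite_polyhedron_faces[OF E] by simp
  show "range (\<lambda>z. {x. z \<in> subdifferential g x}) \<subseteq> insert {} ((`) fst ` {F. F face_of ?E})"
  proof safe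
    fix z x0 assume "{x. z \<in> subdifferential g x} \<notin> (`) fst ` {F. F face_of ?E}"
      and z0: "z \<in> subdifferential g x0"
    obtain r0 where r0: "g x0 = ereal r0"
      and low: "\<And>y s. g y \<le> ereal s \<Longrightarrow> r0 + z \<bullet> (y - x0) \<le> s"
      using z0 by (auto simp: mem_subdifferential_iff)
    define F where "F = ?E \<inter> {p. (z, -1) \<bullet> p = z \<bullet> x0 - r0}"
    have "F face_of ?E"
      unfolding F_def using polyhedron_imp_convex[OF E] low
      by (intro face_of_Int_supporting_hyperplane_le) (force simp: inner_diff_right)+
    moreover have "{x. z \<in> subdifferential g x} = fst ` F"
      unfolding subdifferential_inverse_eq_sublevel[OF r0 z0]
    proof safe
      fix x assume "g x \<le> ereal (r0 + z \<bullet> (x - x0))"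
      then show "x \<in> fst ` F"
        by (intro image_eqI[of _ _ "(x, r0 + z \<bullet> (x - x0))"]) (auto simp: F_def inner_diff_right)
    next
      fix x s assume "(x, s) \<in> F"
      then have "g x \<le> ereal s" "s = r0 + z \<bullet> (x - x0)" by (auto simp: F_def inner_diff_right)
      then show "g (fst (x, s)) \<le> ereal (r0 + z \<bullet> (fst (x, s) - x0))" by simp
    qed
    ultimately show "x0 \<in> {}"
      using \<open>_ \<notin> _\<close> by blast
  qed
qed

text \<open>The two local inclusions follow from finiteness. Here, the finitely many closed sets
  \<open>{y. z \<in> subdifferential g y}\<close> that miss \<open>x\<close> also miss a neighbourhood of \<open>x\<close>.\<close>

lemma subdifferential_locally_subset:
  fixes g :: "'a::euclidean_space \<Rightarrow> ereal"
  assumes poly: "convex_polyhedral g"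
  shows "\<forall>\<^sub>F y in nhds x. subdifferential g y \<subseteq> subdifferential g x"
proof -
  define \<S> where "\<S> = range (\<lambda>z. {y. z \<in> subdifferential g y})"
  have "closed S" if "S \<in> \<S>" for S
    using that polyhedron_imp_closed poly
    by (auto simp: \<S>_def convex_polyhedral_def intro!: closed_subdifferential_inverse)
  then have "\<forall>\<^sub>F y in nhds x. x \<notin> S \<longrightarrow> y \<notin> S" if "S \<in> \<S>" for S
    using that by (cases "x \<in> S") (auto simp: eventually_nhds intro!: exI[of _ "- S"])
  then have "\<forall>\<^sub>F y in nhds x. \<forall>S\<in>\<S>. x \<notin> S \<longrightarrow> y \<notin> S"
    using finite_subdifferential_inverse[OF poly] by (intro eventually_ball_finite) (auto simp: \<S>_def)
  then show ?thesis
    by eventually_elim (auto simp: \<S>_def)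
qed

lemma closed_subdifferential: "closed (subdifferential g (x :: 'a::real_inner))"
proof (cases "\<exists>r. g x = ereal r")
  case True
  then obtain r where r: "g x = ereal r" ..
  have "subdifferential g x = (\<Inter>y. \<Inter>s\<in>{s. g y \<le> ereal s}. {v. r + v \<bullet> (y - x) \<le> s})"
    using r by (auto simp: mem_subdifferential_iff)
  also have "closed \<dots>"
    by (intro closed_INT ballI closed_Collect_le continuous_intros)
  finally show ?thesis .
next
  case False
  then have "subdifferential g x = {}" by (auto simp: mem_subdifferential_iff)
  then show ?thesis by simp
qed

text \<open>The dual statement. A set \<open>S\<close> of the finite family that contains a point \<open>x\<close> at which \<open>v\<close> is not a
  subgradient cannot be the inverse subdifferential at slopes near \<open>v\<close>, because
  \<open>subdifferential g x\<close> is closed.\<close>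

lemma subdifferential_inverse_locally_subset:
  fixes g :: "'a::euclidean_space \<Rightarrow> ereal"
  assumes poly: "convex_polyhedral g"
  shows "\<forall>\<^sub>F z in nhds v. {x. z \<in> subdifferential g x} \<subseteq> {x. v \<in> subdifferential g x}"
proof -
  define \<S> where "\<S> = range (\<lambda>z. {x. z \<in> subdifferential g x})"
  have "\<forall>\<^sub>F z in nhds v. {x. z \<in> subdifferential g x} = S \<longrightarrow> S \<subseteq> {x. v \<in> subdifferential g x}" for S
  proof (cases "S \<subseteq> {x. v \<in> subdifferential g x}")
    case False
    then obtain x where x: "x \<in> S" "v \<notin> subdifferential g x" by blast
    have "\<forall>\<^sub>F z in nhds v. z \<notin> subdifferential g x"
      using x by (auto simp: eventually_nhds intro!: exI[of _ "- subdifferential g x"] open_Compl closed_subdifferential)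
    then show ?thesis by eventually_elim (use x in auto)
  qed simp
  then have "\<forall>\<^sub>F z in nhds v. \<forall>S\<in>\<S>. {x. z \<in> subdifferential g x} = S \<longrightarrow> S \<subseteq> {x. v \<in> subdifferential g x}"
    using finite_subdifferential_inverse[OF poly] by (intro eventually_ball_finite) (auto simp: \<S>_def)
  then show ?thesis
    by eventually_elim (auto simp: \<S>_def)
qed

section \<open>The proximal operator\<close>

lemma prox_imp_subdifferential:
  assumes proper: "proper_fun g" and conv: "convex (ereal_epigraph g)" and a: "a > 0"
    and y: "y \<in> prox a g x"
  shows "(1 / a) *\<^sub>R (x - y) \<in> subdifferential g y"
proof -
  define q where "q u = 1 / (2 * a) * (norm (u - x))\<^sup>2" for u
  have min: "\<not> g u + ereal (q u) < g y + ereal (q y)" for u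
    using y by (auto simp: prox_def is_arg_min_def q_def)
  obtain u0 s0 where u0: "g u0 = ereal s0"
    using proper by (metis ereal_infty_less(1) proper_fun_def ereal_cases)
  obtain r where r: "g y = ereal r"
    using min[of u0] u0 proper by (cases "g y") (auto simp: proper_fun_def)
  have "r + ((1 / a) *\<^sub>R (x - y)) \<bullet> (u - y) \<le> s" if s: "g u \<le> ereal s" for u s
  proof -
    have "r + ((1 / a) *\<^sub>R (x - y)) \<bullet> (u - y) - s \<le> t * ((norm (u - y))\<^sup>2 / (2 * a))"
      if t: "0 < t" "t \<le> 1" for t :: real
    proof -
      have "g (y + t *\<^sub>R (u - y)) \<le> ereal (r + t * (s - r))"
        using t r s by (intro convex_epigraphD[OF conv]) auto
      then have "g (y + t *\<^sub>R (u - y)) + ereal (q (y + t *\<^sub>R (u - y)))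
          \<le> ereal (r + t * (s - r)) + ereal (q (y + t *\<^sub>R (u - y)))"
        by (rule add_right_mono)
      moreover have "ereal (r + q y) \<le> g (y + t *\<^sub>R (u - y)) + ereal (q (y + t *\<^sub>R (u - y)))"
        using min[of "y + t *\<^sub>R (u - y)"] by (simp add: r not_less)
      ultimately have "ereal (r + q y) \<le> ereal (r + t * (s - r)) + ereal (q (y + t *\<^sub>R (u - y)))"
        by (rule order_trans[rotated])
      then have "r + q y \<le> r + t * (s - r) + q (y + t *\<^sub>R (u - y))" by simp
      also have "q (y + t *\<^sub>R (u - y)) = q y + t * (t * ((norm (u - y))\<^sup>2 / (2 * a))
          - ((1 / a) *\<^sub>R (x - y)) \<bullet> (u - y))"
      proof -
        define d where "d = u - y"
        define e where "e = x - y"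
        have "(norm (y + t *\<^sub>R d - x))\<^sup>2 = (norm (t *\<^sub>R d - e))\<^sup>2"
          by (simp add: e_def algebra_simps)
        also have "\<dots> = (norm e)\<^sup>2 + t * (t * (norm d)\<^sup>2 - 2 * (e \<bullet> d))"
          by (simp add: power2_norm_eq_inner inner_diff_left inner_diff_right inner_commute algebra_simps)
        finally have "(norm (y + t *\<^sub>R d - x))\<^sup>2 = (norm e)\<^sup>2 + t * (t * (norm d)\<^sup>2 - 2 * (e \<bullet> d))" .
        moreover have "norm (y - x) = norm e" by (simp add: e_def norm_minus_commute)
        ultimately have "q (y + t *\<^sub>R d) = 1 / (2 * a) * ((norm e)\<^sup>2 + t * (t * (norm d)\<^sup>2 - 2 * (e \<bullet> d)))"
          and "q y = 1 / (2 * a) * (norm e)\<^sup>2" by (simp_all add: q_def)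
        then show ?thesis
          using a by (simp add: field_simps flip: d_def e_def)
      qed
      finally have "t * (r + ((1 / a) *\<^sub>R (x - y)) \<bullet> (u - y) - s) \<le> t * (t * ((norm (u - y))\<^sup>2 / (2 * a)))"
        by (simp add: algebra_simps)
      then show ?thesis using t by (simp only: mult_le_cancel_left_pos)
    qed
    then have "\<forall>\<^sub>F t in at_right 0. r + ((1 / a) *\<^sub>R (x - y)) \<bullet> (u - y) - s \<le> t * ((norm (u - y))\<^sup>2 / (2 * a))"
      by (intro eventually_at_rightI[of 0 1]) auto
    moreover have "((\<lambda>t. t * ((norm (u - y))\<^sup>2 / (2 * a))) \<longlongrightarrow> 0 * ((norm (u - y))\<^sup>2 / (2 * a))) (at_right 0)"
      by (intro tendsto_intros)
    ultimately have "r + ((1 / a) *\<^sub>R (x - y)) \<bullet> (u - y) - s \<le> 0 * ((norm (u - y))\<^sup>2 / (2 * a))"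
      by (intro tendsto_lowerbound) auto
    then show ?thesis by simp
  qed
  then show ?thesis using r by (auto simp: mem_subdifferential_iff)
qed

lemma prox_nonempty:
  fixes g :: "'a::euclidean_space \<Rightarrow> ereal"
  assumes proper: "proper_fun g" and clos: "closed (ereal_epigraph g)" and a: "a > 0"
    and v: "v \<in> subdifferential g x0"
  shows "prox a g x \<noteq> {}"
proof -
  define q where "q u = 1 / (2 * a) * (norm (u - x))\<^sup>2" for u
  obtain r0 where r0: "g x0 = ereal r0"
    and low: "\<And>u s. g u \<le> ereal s \<Longrightarrow> r0 + v \<bullet> (u - x0) \<le> s"
    using v by (auto simp: mem_subdifferential_iff)
  \<comment> \<open>Minimizing over the epigraph replaces the lower semicontinuous objective by a continuous one. The
    affine minorant of \<open>g\<close> at \<open>x0\<close> makes the sublevel set bounded.\<close>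
  define T where "T = ereal_epigraph g \<inter> {p. snd p + q (fst p) \<le> r0 + q x0}"
  have "closed T"
    unfolding T_def q_def
    by (intro closed_Int clos closed_Collect_le continuous_intros)
  moreover have "bounded T"
  proof -
    \<comment> \<open>With \<open>D = norm (u - x)\<close>, Young's inequality \<open>norm v * D \<le> D\<^sup>2 / (4 * a) + a * (norm v)\<^sup>2\<close>
      absorbs the slope of the minorant into half of the quadratic term, so that \<open>D\<^sup>2 \<le> R\<close> on \<open>T\<close>.\<close>
    define R where "R = 4 * a * (q x0 + v \<bullet> (x0 - x) + a * (norm v)\<^sup>2)"
    have bd: "u \<in> cball x (R + 1) \<and> s \<in> {r0 + v \<bullet> (x - x0) - norm v * (R + 1) .. r0 + q x0}"
      if "(u, s) \<in> T" for u s
    proof -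
      define D where "D = norm (u - x)"
      have s: "r0 + v \<bullet> (u - x0) \<le> s" "s + q u \<le> r0 + q x0"
        using that low by (auto simp: T_def)
      have vD: "- (norm v * D) \<le> v \<bullet> (u - x)"
        using Cauchy_Schwarz_ineq2[of v "u - x"] by (simp add: D_def abs_le_iff)
      have "0 \<le> (D - 2 * a * norm v)\<^sup>2 / (4 * a)" using a by simp
      also have "\<dots> = D\<^sup>2 / (4 * a) + a * (norm v)\<^sup>2 - norm v * D"
        using a by (simp add: field_simps power2_eq_square)
      finally have "norm v * D \<le> D\<^sup>2 / (4 * a) + a * (norm v)\<^sup>2" by simp
      moreover have "v \<bullet> (u - x0) = v \<bullet> (u - x) - v \<bullet> (x0 - x)" by (simp add: inner_diff_right)
      moreover have "q u = 2 * (D\<^sup>2 / (4 * a))" by (simp add: q_def D_def)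
      ultimately have "D\<^sup>2 / (4 * a) \<le> q x0 + v \<bullet> (x0 - x) + a * (norm v)\<^sup>2"
        using s vD by linarith
      then have "D\<^sup>2 \<le> R" using a by (simp add: R_def field_simps)
      moreover have "2 * D \<le> D\<^sup>2 + 1" using zero_le_power2[of "D - 1"] by (simp add: power2_diff)
      moreover have "0 \<le> D" by (simp add: D_def)
      ultimately have D: "D \<le> R + 1" by linarith
      have "norm v * D \<le> norm v * (R + 1)" using D by (intro mult_left_mono) auto
      moreover have "v \<bullet> (u - x0) = v \<bullet> (u - x) + v \<bullet> (x - x0)" by (simp add: inner_diff_right)
      moreover have "q u \<ge> 0" using a by (simp add: q_def)
      ultimately show ?thesis
        using s vD D by (auto simp: D_def dist_norm norm_minus_commute)
    qed
    show ?thesis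
      by (rule bounded_subset[OF bounded_Times[OF bounded_cball bounded_closed_interval], of _ x "R + 1"
            "r0 + v \<bullet> (x - x0) - norm v * (R + 1)" "r0 + q x0"])
         (use bd in auto)
  qed
  ultimately have "compact T" by (simp add: compact_eq_bounded_closed)
  moreover have "(x0, r0) \<in> T" by (simp add: T_def r0)
  then have "T \<noteq> {}" by blast
  moreover have "continuous_on T (\<lambda>p. snd p + q (fst p))"
    unfolding q_def by (intro continuous_intros)
  ultimately have "\<exists>p\<in>T. \<forall>p'\<in>T. snd p + q (fst p) \<le> snd p' + q (fst p')"
    by (rule continuous_attains_inf)
  then obtain p where p: "p \<in> T" "\<And>p'. p' \<in> T \<Longrightarrow> snd p + q (fst p) \<le> snd p' + q (fst p')"
    by blast
  obtain y r where yr: "p = (y, r)" by fastforce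
  have y: "g y \<le> ereal r" "r + q y \<le> r0 + q x0" using p(1) yr by (auto simp: T_def)
  have "\<not> g u + ereal (q u) < g y + ereal (q y)" for u
  proof
    assume less: "g u + ereal (q u) < g y + ereal (q y)"
    then obtain s where s: "g u = ereal s"
      using proper by (cases "g u") (auto simp: proper_fun_def)
    have "g y + ereal (q y) \<le> ereal (r + q y)"
      using y(1) by (metis add_right_mono plus_ereal.simps(1))
    with less have "g u + ereal (q u) < ereal (r + q y)" by (rule less_le_trans)
    then have "ereal (s + q u) < ereal (r + q y)" by (simp add: s)
    then have lt: "s + q u < r + q y" by simp
    then have "(u, s) \<in> T" using y(2) s by (simp add: T_def)
    from p(2)[OF this] lt yr show False by simp
  qed
  then have "y \<in> prox a g x" by (auto simp: prox_def is_arg_min_def q_def)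
  then show ?thesis by blast
qed

text \<open>Nonexpansiveness of the proximal operator, stated for its optimality condition.\<close>

lemma norm_prox_diff_le:
  assumes a: "a > 0"
    and y: "(1 / a) *\<^sub>R (x - y) \<in> subdifferential g y"
    and y': "(1 / a) *\<^sub>R (x' - y') \<in> subdifferential g y'"
  shows "norm (y - y') \<le> norm (x - x')"
proof -
  have "0 \<le> a * (((1 / a) *\<^sub>R (x - y) - (1 / a) *\<^sub>R (x' - y')) \<bullet> (y - y'))"
    using subdifferential_monotone[OF y y'] a by simp
  also have "\<dots> = a * ((1 / a) * (((x - x') - (y - y')) \<bullet> (y - y')))"
    by (simp only: inner_scaleR_left flip: scaleR_diff_right) (simp add: algebra_simps)
  also have "\<dots> = ((x - x') - (y - y')) \<bullet> (y - y')"
    using a by simp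
  finally have "norm (y - y') * norm (y - y') \<le> (x - x') \<bullet> (y - y')"
    by (simp add: inner_diff_left flip: power2_norm_eq_inner power2_eq_square)
  also have "\<dots> \<le> norm (x - x') * norm (y - y')" by (rule norm_cauchy_schwarz)
  finally show ?thesis
    by (cases "y = y'") auto
qed

section \<open>Twice differentiable convex functions\<close>

lemma GDERIV_along_line:
  assumes "GDERIV f (x + t *\<^sub>R w) :> D"
  shows "((\<lambda>t. f (x + t *\<^sub>R w)) has_real_derivative D \<bullet> w) (at t)"
proof -
  have "((\<lambda>t. x + t *\<^sub>R w) has_derivative (\<lambda>h. h *\<^sub>R w)) (at t)"
    by (auto intro!: derivative_eq_intros)
  from has_derivative_compose[OF this assms[unfolded gderiv_def]]
  show ?thesis
    by (simp add: has_field_derivative_def inner_commute mult_commute_abs)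
qed

lemma has_derivative_inner_along_line:
  fixes F :: "'a::real_inner \<Rightarrow> 'a" and A :: "'a \<Rightarrow>\<^sub>L 'a"
  assumes "(F has_derivative blinfun_apply A) (at (x + t *\<^sub>R w))"
  shows "((\<lambda>t. F (x + t *\<^sub>R w) \<bullet> v) has_real_derivative A w \<bullet> v) (at t)"
proof -
  have "((\<lambda>t. x + t *\<^sub>R w) has_derivative (\<lambda>h. h *\<^sub>R w)) (at t)"
    by (auto intro!: derivative_eq_intros)
  from has_derivative_inner_left[OF has_derivative_compose[OF this assms], of v]
  show ?thesis
    by (simp add: has_field_derivative_def blinfun.scaleR_right mult_commute_abs)
qed

lemma directional_quotient_tendsto:
  fixes f :: "'a::real_inner \<Rightarrow> real"
  assumes "GDERIV f x :> D"
  shows "((\<lambda>t. (f (x + t *\<^sub>R w) - f x) / t) \<longlongrightarrow> D \<bullet> w) (at_right 0)"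
  using GDERIV_along_line[of f x 0 w D] assms
  by (auto simp: DERIV_def intro: tendsto_within_subset)

lemma convex_gradient_le:
  fixes f :: "'a::real_inner \<Rightarrow> real"
  assumes conv: "convex_on UNIV f" and grad: "GDERIV f x :> D"
  shows "f x + D \<bullet> (y - x) \<le> f y"
proof -
  have "(f (x + t *\<^sub>R (y - x)) - f x) / t \<le> f y - f x" if t: "0 < t" "t < 1" for t :: real
  proof -
    have "f ((1 - t) *\<^sub>R x + t *\<^sub>R y) \<le> (1 - t) * f x + t * f y"
      using t by (intro convex_onD[OF conv]) auto
    then have "f (x + t *\<^sub>R (y - x)) - f x \<le> t * (f y - f x)"
      by (simp add: algebra_simps)
    then show ?thesis using t by (simp add: divide_le_eq mult.commute)
  qed
  then have "\<forall>\<^sub>F t in at_right 0. (f (x + t *\<^sub>R (y - x)) - f x) / t \<le> f y - f x"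
    by (intro eventually_at_rightI[of 0 1]) auto
  then have "D \<bullet> (y - x) \<le> f y - f x"
    by (intro tendsto_upperbound[OF directional_quotient_tendsto[OF grad]]) auto
  then show ?thesis by simp
qed

text \<open>Two applications of the mean value theorem turn the second difference into a value of the
  Hessian. Its symmetry in \<open>u\<close> and \<open>v\<close> yields the symmetry of the Hessian.\<close>

lemma second_difference_eq:
  fixes f :: "'a::real_inner \<Rightarrow> real" and f'' :: "'a \<Rightarrow> 'a \<Rightarrow>\<^sub>L 'a"
  assumes grad: "\<And>x. GDERIV f x :> f' x"
    and hess: "\<And>x. (f' has_derivative blinfun_apply (f'' x)) (at x)"
    and t: "t > 0"
  shows "\<exists>p. norm (p - x) \<le> t * (norm u + norm v) \<and>
    f (x + t *\<^sub>R u + t *\<^sub>R v) - f (x + t *\<^sub>R u) - f (x + t *\<^sub>R v) + f x = t\<^sup>2 * (f'' p u \<bullet> v)"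
proof -
  have "\<exists>s>0. s < t \<and> (f (x + t *\<^sub>R u + t *\<^sub>R v) - f (x + t *\<^sub>R v))
        - (f (x + t *\<^sub>R u + 0 *\<^sub>R v) - f (x + 0 *\<^sub>R v))
      = (t - 0) * (f' (x + t *\<^sub>R u + s *\<^sub>R v) \<bullet> v - f' (x + s *\<^sub>R v) \<bullet> v)"
    by (rule MVT2[OF t, where f = "\<lambda>s. f (x + t *\<^sub>R u + s *\<^sub>R v) - f (x + s *\<^sub>R v)"])
       (intro DERIV_diff GDERIV_along_line grad)
  then obtain s where s: "0 < s" "s < t"
    and eq1: "f (x + t *\<^sub>R u + t *\<^sub>R v) - f (x + t *\<^sub>R v) - f (x + t *\<^sub>R u) + f x
      = t * (f' (x + t *\<^sub>R u + s *\<^sub>R v) \<bullet> v - f' (x + s *\<^sub>R v) \<bullet> v)"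
    by auto
  have "\<exists>\<tau>>0. \<tau> < t \<and> f' (x + s *\<^sub>R v + t *\<^sub>R u) \<bullet> v - f' (x + s *\<^sub>R v + 0 *\<^sub>R u) \<bullet> v
      = (t - 0) * (f'' (x + s *\<^sub>R v + \<tau> *\<^sub>R u) u \<bullet> v)"
    by (rule MVT2[OF t, where f = "\<lambda>\<tau>. f' (x + s *\<^sub>R v + \<tau> *\<^sub>R u) \<bullet> v"])
       (intro has_derivative_inner_along_line hess)
  then obtain \<tau> where \<tau>: "0 < \<tau>" "\<tau> < t"
    and eq2: "f' (x + t *\<^sub>R u + s *\<^sub>R v) \<bullet> v - f' (x + s *\<^sub>R v) \<bullet> v
      = t * (f'' (x + s *\<^sub>R v + \<tau> *\<^sub>R u) u \<bullet> v)"
    by (auto simp: add_ac)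
  have "norm (s *\<^sub>R v + \<tau> *\<^sub>R u) \<le> s * norm v + \<tau> * norm u"
    using s \<tau> norm_triangle_ineq[of "s *\<^sub>R v" "\<tau> *\<^sub>R u"] by simp
  also have "\<dots> \<le> t * norm v + t * norm u"
    using s \<tau> by (intro add_mono mult_right_mono) auto
  finally have "norm ((x + s *\<^sub>R v + \<tau> *\<^sub>R u) - x) \<le> t * (norm u + norm v)"
    by (simp add: algebra_simps)
  moreover have "f (x + t *\<^sub>R u + t *\<^sub>R v) - f (x + t *\<^sub>R u) - f (x + t *\<^sub>R v) + f x
      = t\<^sup>2 * (f'' (x + s *\<^sub>R v + \<tau> *\<^sub>R u) u \<bullet> v)"
    using eq1 unfolding eq2 by (simp add: power2_eq_square)
  ultimately show ?thesis by blast
qed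

lemma hessian_symmetric:
  fixes f :: "'a::real_inner \<Rightarrow> real" and f'' :: "'a \<Rightarrow> 'a \<Rightarrow>\<^sub>L 'a"
  assumes grad: "\<And>x. GDERIV f x :> f' x"
    and hess: "\<And>x. (f' has_derivative blinfun_apply (f'' x)) (at x)"
    and cont: "isCont f'' x"
  shows "f'' x u \<bullet> v = f'' x v \<bullet> u"
proof (rule ccontr)
  assume neq: "f'' x u \<bullet> v \<noteq> f'' x v \<bullet> u"
  define e where "e = dist (f'' x u \<bullet> v) (f'' x v \<bullet> u) / 2"
  have e: "e > 0" using neq by (simp add: e_def)
  have lim: "((\<lambda>p. f'' p u \<bullet> v) \<longlongrightarrow> f'' x u \<bullet> v) (nhds x)" for u v
    using cont unfolding isCont_def tendsto_at_iff_tendsto_nhds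
    by (intro tendsto_intros)
  have "\<forall>\<^sub>F p in nhds x. dist (f'' p u \<bullet> v) (f'' x u \<bullet> v) < e"
    "\<forall>\<^sub>F p in nhds x. dist (f'' p v \<bullet> u) (f'' x v \<bullet> u) < e"
    using lim[of u v] lim[of v u] e by (auto dest: tendstoD)
  then obtain d where d: "d > 0"
    and close: "\<And>p. dist p x < d \<Longrightarrow> dist (f'' p u \<bullet> v) (f'' x u \<bullet> v) < e"
      "\<And>p. dist p x < d \<Longrightarrow> dist (f'' p v \<bullet> u) (f'' x v \<bullet> u) < e"
    unfolding eventually_nhds_metric by (metis min_less_iff_conj)
  define t where "t = d / (norm u + norm v + 1)"
  have pos: "0 < norm u + norm v + 1" by (simp add: add_nonneg_pos)
  then have t: "t > 0" using d by (simp add: t_def)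
  have "t * (norm u + norm v) < t * (norm u + norm v + 1)" using t by simp
  also have "\<dots> = d" using pos by (simp add: t_def)
  finally have td: "t * (norm u + norm v) < d" .
  obtain p where p: "norm (p - x) \<le> t * (norm u + norm v)"
    "f (x + t *\<^sub>R u + t *\<^sub>R v) - f (x + t *\<^sub>R u) - f (x + t *\<^sub>R v) + f x = t\<^sup>2 * (f'' p u \<bullet> v)"
    using second_difference_eq[OF grad hess t, of x u v] by blast
  obtain q where q: "norm (q - x) \<le> t * (norm v + norm u)"
    "f (x + t *\<^sub>R v + t *\<^sub>R u) - f (x + t *\<^sub>R v) - f (x + t *\<^sub>R u) + f x = t\<^sup>2 * (f'' q v \<bullet> u)"
    using second_difference_eq[OF grad hess t, of x v u] by blast
  have "f (x + t *\<^sub>R v + t *\<^sub>R u) = f (x + t *\<^sub>R u + t *\<^sub>R v)" by (simp add: add_ac)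
  with p(2) q(2) have "t\<^sup>2 * (f'' p u \<bullet> v) = t\<^sup>2 * (f'' q v \<bullet> u)" by linarith
  then have "f'' p u \<bullet> v = f'' q v \<bullet> u" using t by simp
  moreover have "dist (f'' p u \<bullet> v) (f'' x u \<bullet> v) < e"
    using p(1) td by (intro close) (simp add: dist_norm)
  moreover have "dist (f'' q v \<bullet> u) (f'' x v \<bullet> u) < e"
    using q(1) td by (intro close) (simp add: dist_norm add.commute)
  ultimately show False unfolding e_def dist_real_def by (smt (verit) field_sum_of_halves)
qed

lemma hessian_nonneg:
  fixes f :: "'a::real_inner \<Rightarrow> real" and A :: "'a \<Rightarrow>\<^sub>L 'a"
  assumes conv: "convex_on UNIV f" and grad: "\<And>x. GDERIV f x :> f' x"
    and hess: "(f' has_derivative blinfun_apply A) (at x)"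
  shows "0 \<le> A w \<bullet> w"
proof -
  have "0 \<le> (f' (x + t *\<^sub>R w) \<bullet> w - f' x \<bullet> w) / t" if t: "0 < t" for t :: real
  proof -
    have "0 \<le> (f' (x + t *\<^sub>R w) - f' x) \<bullet> (t *\<^sub>R w)"
      using convex_gradient_le[OF conv grad, of x "x + t *\<^sub>R w"]
        convex_gradient_le[OF conv grad, of "x + t *\<^sub>R w" x]
      by (simp add: inner_diff_left algebra_simps)
    then show ?thesis using t by (simp add: zero_le_mult_iff inner_diff_left)
  qed
  then have "\<forall>\<^sub>F t in at_right 0. 0 \<le> (f' (x + t *\<^sub>R w) \<bullet> w - f' x \<bullet> w) / t"
    by (intro eventually_at_rightI[of 0 1]) auto
  moreover have "((\<lambda>t. (f' (x + t *\<^sub>R w) \<bullet> w - f' x \<bullet> w) / t) \<longlongrightarrow> A w \<bullet> w) (at_right 0)"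
    using has_derivative_inner_along_line[of f' A x 0 w w] hess
    by (auto simp: DERIV_def intro: tendsto_within_subset)
  ultimately show ?thesis by (intro tendsto_lowerbound) auto
qed

lemma hessian_taylor_bound:
  fixes f' :: "'a::real_normed_vector \<Rightarrow> 'a" and f'' :: "'a \<Rightarrow> 'a \<Rightarrow>\<^sub>L 'a"
  assumes hess: "\<And>x. (f' has_derivative blinfun_apply (f'' x)) (at x)"
    and lip: "K-lipschitz_on S f''" and S: "convex S" and xy: "x \<in> S" "y \<in> S"
  shows "norm (f' y - f' x - f'' y (y - x)) \<le> K * (norm (y - x))\<^sup>2"
proof -
  let ?S = "closed_segment x y"
  have seg: "x + t *\<^sub>R (y - x) \<in> ?S" if "t \<in> {0..1}" for t
    using that by (auto simp: closed_segment_def algebra_simps intro!: exI[of _ t])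
  have deriv: "(f' has_derivative blinfun_apply (f'' u)) (at u within ?S)" for u
    by (rule has_derivative_at_withinI[OF hess])
  have bound: "onorm (\<lambda>w. f'' u w - f'' y w) \<le> K * norm (y - x)" if u: "u \<in> ?S" for u
  proof -
    have "u \<in> S" using u xy S by (meson closed_segment_subset subsetD)
    then have "dist (f'' u) (f'' y) \<le> K * dist u y" using lip xy by (auto dest: lipschitz_onD)
    also have "\<dots> \<le> K * norm (y - x)"
      using u lipschitz_on_nonneg[OF lip] segment_bound(2)[OF u]
      by (intro mult_left_mono) (auto simp: dist_norm norm_minus_commute)
    finally show ?thesis by (simp add: dist_norm norm_blinfun.rep_eq minus_blinfun.rep_eq)
  qed
  have "norm (f' y - f' x - f'' y (y - x)) \<le> norm (y - x) * (K * norm (y - x))"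
    using differentiable_bound_linearization[of x y ?S f' "\<lambda>u. blinfun_apply (f'' u)" y, OF seg deriv]
      bound by (simp add: fun_diff_def)
  then show ?thesis by (simp add: power2_eq_square mult_ac)
qed

lemma strictly_differentiable_bound:
  fixes f' :: "'a::real_normed_vector \<Rightarrow> 'a" and f'' :: "'a \<Rightarrow> 'a \<Rightarrow>\<^sub>L 'a"
  assumes hess: "\<And>x. (f' has_derivative blinfun_apply (f'' x)) (at x)"
    and cont: "isCont f'' x0" and e: "e > 0"
  shows "\<exists>\<rho>>0. \<forall>x\<in>ball x0 \<rho>. \<forall>y\<in>ball x0 \<rho>.
    norm (f' y - f' x - f'' x0 (y - x)) \<le> e * norm (y - x)"
proof -
  obtain \<rho> where \<rho>: "\<rho> > 0" and close: "\<And>u. dist u x0 < \<rho> \<Longrightarrow> dist (f'' u) (f'' x0) < e"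
    using cont e unfolding continuous_at_eps_delta by blast
  have "norm (f' y - f' x - f'' x0 (y - x)) \<le> e * norm (y - x)"
    if x: "x \<in> ball x0 \<rho>" and y: "y \<in> ball x0 \<rho>" for x y
  proof -
    have seg: "x + t *\<^sub>R (y - x) \<in> ball x0 \<rho>" if "t \<in> {0..1}" for t
      using convexD_alt[OF convex_ball x y, of t] that by (simp add: algebra_simps)
    have deriv: "(f' has_derivative blinfun_apply (f'' u)) (at u within ball x0 \<rho>)" for u
      by (rule has_derivative_at_withinI[OF hess])
    have bound: "onorm (\<lambda>w. f'' u w - f'' x0 w) \<le> e" if "u \<in> ball x0 \<rho>" for u
      using close[of u] that
      by (simp add: dist_norm norm_blinfun.rep_eq minus_blinfun.rep_eq norm_minus_commute)
    show ?thesis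
      using differentiable_bound_linearization[of x y "ball x0 \<rho>" f' "\<lambda>u. blinfun_apply (f'' u)" x0,
          OF seg deriv] bound \<rho> by (simp add: fun_diff_def mult.commute)
  qed
  with \<rho> show ?thesis by blast
qed

text \<open>This is the form in which positive semidefiniteness gives \<open>A w \<bullet> w = 0 \<Longrightarrow> A w = 0\<close>
  with a constant. It results from the nonnegativity of the form at \<open>N *\<^sub>R w - A w\<close>, where \<open>N = norm A + 1\<close>.\<close>

lemma norm_apply_le_quadratic_form:
  fixes A :: "'a::real_inner \<Rightarrow>\<^sub>L 'a"
  assumes sym: "\<And>u v. A u \<bullet> v = A v \<bullet> u" and psd: "\<And>u. 0 \<le> A u \<bullet> u"
  shows "(norm (A w))\<^sup>2 \<le> (norm A + 1) * (A w \<bullet> w)"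
proof -
  define N where "N = norm A + 1"
  have N: "N > 0" by (simp add: N_def add_nonneg_pos)
  define n where "n = (norm (A w))\<^sup>2"
  have "A (A w) \<bullet> A w \<le> norm (A (A w)) * norm (A w)" by (rule norm_cauchy_schwarz)
  also have "\<dots> \<le> (norm A * norm (A w)) * norm (A w)"
    by (intro mult_right_mono norm_blinfun) auto
  also have "\<dots> \<le> N * n" by (simp add: N_def n_def power2_eq_square algebra_simps)
  finally have AA: "A (A w) \<bullet> A w \<le> N * n" .
  have "0 \<le> A (N *\<^sub>R w - A w) \<bullet> (N *\<^sub>R w - A w)" by (rule psd)
  also have "\<dots> = N * (N * (A w \<bullet> w)) - 2 * N * n + A (A w) \<bullet> A w"
    using sym[of "A w" w]
    by (simp add: blinfun.diff_right blinfun.scaleR_right inner_diff_left inner_diff_right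
        n_def power2_norm_eq_inner algebra_simps)
  finally have "0 \<le> N * (N * (A w \<bullet> w) - n)" using AA by (simp add: algebra_simps)
  then show ?thesis using N by (simp add: zero_le_mult_iff N_def n_def)
qed

lemma coercive_if_norm_apply_bound:
  fixes A :: "'a::real_inner \<Rightarrow>\<^sub>L 'a"
  assumes sym: "\<And>u v. A u \<bullet> v = A v \<bullet> u" and psd: "\<And>u. 0 \<le> A u \<bullet> u"
    and bound: "\<And>w. w \<in> L \<Longrightarrow> norm w \<le> \<kappa> * norm (A w)"
  shows "\<exists>c>0. \<forall>w\<in>L. c * (norm w)\<^sup>2 \<le> A w \<bullet> w"
proof -
  define M where "M = \<kappa>\<^sup>2 * (norm A + 1) + 1"
  have M: "M > 0" by (simp add: M_def add_nonneg_pos)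
  have "1 / M * (norm w)\<^sup>2 \<le> A w \<bullet> w" if w: "w \<in> L" for w
  proof -
    have "(norm w)\<^sup>2 \<le> \<kappa>\<^sup>2 * (norm (A w))\<^sup>2"
      using power_mono[OF bound[OF w], of 2] by (simp add: power_mult_distrib)
    also have "\<dots> \<le> \<kappa>\<^sup>2 * ((norm A + 1) * (A w \<bullet> w))"
      by (intro mult_left_mono norm_apply_le_quadratic_form sym psd) auto
    also have "\<dots> \<le> M * (A w \<bullet> w)" using psd[of w] by (simp add: M_def algebra_simps)
    finally show ?thesis using M by (simp add: field_simps)
  qed
  then show ?thesis using M by (intro exI[of _ "1 / M"]) auto
qed

section \<open>Quadratic minimization over a subspace\<close>

lemma quadratic_minimizer_stationary:
  fixes A :: "'a::real_inner \<Rightarrow>\<^sub>L 'a"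
  assumes L: "subspace L" and sym: "\<And>u v. A u \<bullet> v = A v \<bullet> u"
    and d: "is_arg_min (\<lambda>d. 1 / 2 * (A d \<bullet> d) - b \<bullet> d) (\<lambda>d. d \<in> L) d" and w: "w \<in> L"
  shows "(A d - b) \<bullet> w = 0"
proof -
  define p where "p = (A d - b) \<bullet> w"
  define r where "r = A w \<bullet> w / 2"
  have quad: "0 \<le> t * p + t\<^sup>2 * r" for t
  proof -
    have "d + t *\<^sub>R w \<in> L"
      using d w L by (auto simp: is_arg_min_linorder intro!: subspace_add subspace_scale)
    then have "1 / 2 * (A d \<bullet> d) - b \<bullet> d
        \<le> 1 / 2 * (A (d + t *\<^sub>R w) \<bullet> (d + t *\<^sub>R w)) - b \<bullet> (d + t *\<^sub>R w)"
      using d by (simp add: is_arg_min_linorder)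
    also have "\<dots> = 1 / 2 * (A d \<bullet> d) - b \<bullet> d + (t * p + t\<^sup>2 * r)"
      using sym[of w d]
      by (simp add: p_def r_def blinfun.add_right blinfun.scaleR_right inner_add_left inner_add_right
          inner_diff_left power2_eq_square algebra_simps)
    finally show ?thesis by simp
  qed
  \<comment> \<open>The step \<open>t = - p / K\<close> makes the quadratic negative unless \<open>p = 0\<close>.\<close>
  define K where "K = \<bar>r\<bar> + 1"
  have K: "K > 0" "r - K < 0" by (auto simp: K_def)
  have "0 \<le> K\<^sup>2 * ((- p / K) * p + (- p / K)\<^sup>2 * r)" using quad[of "- p / K"]
    by (rule mult_nonneg_nonneg[OF zero_le_power2])
  also have "\<dots> = p\<^sup>2 * (r - K)" using K by (simp add: field_simps power2_eq_square)
  finally have "p\<^sup>2 \<le> 0" using K by (simp add: zero_le_mult_iff)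
  then show ?thesis by (simp add: p_def)
qed

lemma quadratic_minimizer_exists:
  fixes A :: "'a::euclidean_space \<Rightarrow>\<^sub>L 'a"
  assumes L: "subspace L" and c: "c > 0" and coercive: "\<And>w. w \<in> L \<Longrightarrow> c * (norm w)\<^sup>2 \<le> A w \<bullet> w"
  shows "\<exists>d. is_arg_min (\<lambda>d. 1 / 2 * (A d \<bullet> d) - b \<bullet> d) (\<lambda>d. d \<in> L) d"
proof -
  let ?q = "\<lambda>d. 1 / 2 * (A d \<bullet> d) - b \<bullet> d"
  define T where "T = L \<inter> {d. ?q d \<le> 0}"
  have "closed T"
    unfolding T_def by (intro closed_Int closed_subspace L closed_Collect_le continuous_intros)
  moreover have "T \<subseteq> cball 0 (2 * norm b / c)"
  proof
    fix d assume d: "d \<in> T"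
    then have "c * (norm d)\<^sup>2 \<le> 2 * (b \<bullet> d)" using coercive[of d] by (auto simp: T_def)
    also have "b \<bullet> d \<le> norm b * norm d" by (rule norm_cauchy_schwarz)
    finally have "(c * norm d) * norm d \<le> (2 * norm b) * norm d" by (simp add: power2_eq_square)
    then have "c * norm d \<le> 2 * norm b \<or> d = 0" by auto
    then show "d \<in> cball 0 (2 * norm b / c)" using c by (auto simp: field_simps)
  qed
  ultimately have "compact T"
    by (meson bounded_cball bounded_subset compact_eq_bounded_closed)
  moreover have "0 \<in> T" using L by (simp add: T_def subspace_0)
  then have "T \<noteq> {}" by blast
  moreover have "continuous_on T ?q" by (intro continuous_intros)
  ultimately have "\<exists>d\<in>T. \<forall>d'\<in>T. ?q d \<le> ?q d'"
    by (rule continuous_attains_inf)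
  then obtain d where d: "d \<in> T" "\<And>d'. d' \<in> T \<Longrightarrow> ?q d \<le> ?q d'" by blast
  have "?q d \<le> ?q d'" if "d' \<in> L" for d'
    using d that by (cases "?q d' \<le> 0") (auto simp: T_def)
  then show ?thesis using d(1) by (auto simp: is_arg_min_linorder T_def)
qed

text \<open>If \<open>e \<in> L\<close> satisfies the stationarity condition of the quadratic model up to \<open>R\<close>, then its distance to
  the minimizer is at most \<open>R / c\<close>. In the application \<open>e\<close> is the error \<open>y - xbar\<close> before the Newton correction
  and \<open>e - d\<close> is the error after it.\<close>

lemma newton_step_error:
  fixes A :: "'a::real_inner \<Rightarrow>\<^sub>L 'a"
  assumes L: "subspace L" and sym: "\<And>u v. A u \<bullet> v = A v \<bullet> u"
    and c: "c > 0" and coercive: "\<And>w. w \<in> L \<Longrightarrow> c * (norm w)\<^sup>2 \<le> A w \<bullet> w"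
    and d: "is_arg_min (\<lambda>d. 1 / 2 * (A d \<bullet> d) - b \<bullet> d) (\<lambda>d. d \<in> L) d"
    and e: "e \<in> L"
    and R: "0 \<le> R" and res: "\<And>w. w \<in> L \<Longrightarrow> (A e - b) \<bullet> w \<le> R * norm w"
  shows "norm (e - d) \<le> R / c"
proof (cases "e = d")
  case True
  then show ?thesis using R c by simp
next
  case False
  have mem: "e - d \<in> L" using d e L by (auto simp: is_arg_min_linorder intro: subspace_diff)
  have "c * (norm (e - d))\<^sup>2 \<le> A (e - d) \<bullet> (e - d)" by (rule coercive[OF mem])
  also have "\<dots> = (A e - b) \<bullet> (e - d) - (A d - b) \<bullet> (e - d)"
    by (simp add: blinfun.diff_right inner_diff_left)
  also have "\<dots> \<le> R * norm (e - d)"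
    using quadratic_minimizer_stationary[OF L sym d mem] res[OF mem] by simp
  finally have "norm (e - d) * (c * norm (e - d)) \<le> norm (e - d) * R"
    by (simp add: power2_eq_square mult_ac)
  then show ?thesis using False c by (simp add: field_simps)
qed

section \<open>Tilt stability\<close>

text \<open>The point \<open>u\<close> is taken from the relative interior of \<open>S\<close>.\<close>

lemma convex_parallel_direction:
  fixes S :: "'a::euclidean_space set"
  assumes S: "convex S" "S \<noteq> {}" and w: "w \<in> parallel_span S"
  shows "\<exists>u\<in>S. \<exists>s>0. u + s *\<^sub>R w \<in> S"
proof -
  obtain u where "u \<in> rel_interior S" using S by (auto simp flip: rel_interior_eq_empty)
  then obtain e where u: "u \<in> S" and e: "e > 0" and sub: "ball u e \<inter> affine hull S \<subseteq> S"
    by (auto simp: mem_rel_interior_ball)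
  define s where "s = e / (norm w + 1)"
  have pos: "0 < norm w + 1" by (simp add: add_nonneg_pos)
  have s: "s > 0" using e pos by (simp add: s_def)
  have "s * norm w < s * (norm w + 1)" using s by simp
  also have "\<dots> = e" using pos by (simp add: s_def)
  finally have "u + s *\<^sub>R w \<in> ball u e" using s by (simp add: dist_norm)
  moreover have "s *\<^sub>R w \<in> span ((\<lambda>x. - u + x) ` S)"
    using w parallel_span_eq[OF u] by (auto intro: span_scale)
  then have "u + s *\<^sub>R w \<in> affine hull S"
    using affine_hull_span_gen[OF hull_inc[OF u]] by auto
  ultimately show ?thesis using sub u s by blast
qed

lemma tilt_stable_imp_stationary:
  fixes f :: "'a::real_inner \<Rightarrow> real"
  assumes proper: "proper_fun g" and conv: "convex (ereal_epigraph g)"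
    and grad: "GDERIV f xbar :> D"
    and tilt: "tilt_stable_minimizer (\<lambda>x. ereal (f x) + g x) xbar"
  shows "- D \<in> subdifferential g xbar"
proof -
  obtain \<gamma> where \<gamma>: "\<gamma> > 0"
    and "tilt_argmin (\<lambda>x. ereal (f x) + g x) xbar \<gamma> 0 = {xbar}"
    and fin: "ereal (f xbar) + g xbar < \<infinity>"
    using tilt by (auto simp: tilt_stable_minimizer_def)
  then have min: "ereal (f xbar) + g xbar \<le> ereal (f x) + g x" if "norm (x - xbar) \<le> \<gamma>" for x
    using that by (auto simp: tilt_argmin_def is_arg_min_linorder set_eq_iff)
  obtain r where r: "g xbar = ereal r"
    using fin proper by (cases "g xbar") (auto simp: proper_fun_def)
  have "r + (- D) \<bullet> (u - xbar) \<le> s" if s: "g u \<le> ereal s" for u s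
  proof -
    define w where "w = u - xbar"
    define T where "T = min 1 (\<gamma> / (norm w + 1))"
    have pos: "0 < norm w + 1" by (simp add: add_nonneg_pos)
    have T: "T > 0" using \<gamma> pos by (simp add: T_def)
    have "r - s \<le> (f (xbar + t *\<^sub>R w) - f xbar) / t" if t: "0 < t" "t < T" for t
    proof -
      have "t * norm w \<le> t * (norm w + 1)" using t by simp
      also have "\<dots> \<le> \<gamma>" using t pos by (simp add: T_def pos_less_divide_eq less_imp_le)
      finally have "ereal (f xbar) + g xbar \<le> ereal (f (xbar + t *\<^sub>R w)) + g (xbar + t *\<^sub>R w)"
        using t by (intro min) simp
      also have "\<dots> \<le> ereal (f (xbar + t *\<^sub>R w)) + ereal (r + t * (s - r))"
        unfolding w_def using t r s by (intro add_left_mono convex_epigraphD[OF conv]) (auto simp: T_def)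
      finally have "t * (r - s) \<le> f (xbar + t *\<^sub>R w) - f xbar"
        by (simp add: r algebra_simps)
      then show ?thesis using t by (simp add: le_divide_eq mult.commute)
    qed
    then have "\<forall>\<^sub>F t in at_right 0. r - s \<le> (f (xbar + t *\<^sub>R w) - f xbar) / t"
      using T by (intro eventually_at_rightI[of 0 T]) auto
    then have "r - s \<le> D \<bullet> w"
      by (intro tendsto_lowerbound[OF directional_quotient_tendsto[OF grad]]) auto
    then show ?thesis by (simp add: w_def)
  qed
  then show ?thesis using r by (auto simp: mem_subdifferential_iff)
qed

text \<open>Where \<open>v - D\<close> is a subgradient of \<open>g\<close>, the point \<open>x\<close> minimizes the function tilted by \<open>v\<close> globally.\<close>

lemma mem_tilt_argmin:
  fixes f :: "'a::real_inner \<Rightarrow> real"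
  assumes proper: "proper_fun g" and conv: "convex_on UNIV f" and grad: "GDERIV f x :> D"
    and v: "v - D \<in> subdifferential g x" and x: "norm (x - xbar) \<le> \<gamma>"
  shows "x \<in> tilt_argmin (\<lambda>x. ereal (f x) + g x) xbar \<gamma> v"
proof -
  obtain r where r: "g x = ereal r"
    and low: "\<And>y s. g y \<le> ereal s \<Longrightarrow> r + (v - D) \<bullet> (y - x) \<le> s"
    using v by (auto simp: mem_subdifferential_iff)
  have "ereal (f x) + g x - ereal (v \<bullet> x) \<le> ereal (f y) + g y - ereal (v \<bullet> y)" for y
  proof (cases "g y")
    case (real s)
    then show ?thesis
      using low[of y s] convex_gradient_le[OF conv grad, of y] r
      by (simp add: inner_diff_left inner_diff_right)
  qed (use proper in \<open>auto simp: proper_fun_def\<close>)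
  then show ?thesis using x by (auto simp: tilt_argmin_def is_arg_min_linorder)
qed

text \<open>A quantitative form of the condition that the kernel of the Hessian meets the parallel subspace
  trivially. On the set \<open>S\<close> of points at which \<open>- f' xbar\<close> is a subgradient of \<open>g\<close>, every \<open>x\<close> near
  \<open>xbar\<close> is the minimizer for the tilt \<open>f' x - f' xbar\<close>. Lipschitz continuity of the minimizer therefore bounds
  \<open>norm (y - x)\<close> by a multiple of \<open>norm (f' y - f' x)\<close> for \<open>x, y \<in> S\<close> near \<open>xbar\<close>, and \<open>f' y - f' x\<close>
  is the Hessian applied to \<open>y - x\<close> up to a small multiple of \<open>norm (y - x)\<close>. Every \<open>w\<close> of the parallel
  subspace is a multiple of such a difference.\<close>

lemma tilt_stable_imp_hessian_bound:
  fixes f :: "'a::euclidean_space \<Rightarrow> real" and f'' :: "'a \<Rightarrow> 'a \<Rightarrow>\<^sub>L 'a"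
  assumes proper: "proper_fun g" and conv: "convex (ereal_epigraph g)"
    and f_conv: "convex_on UNIV f" and grad: "\<And>x. GDERIV f x :> f' x"
    and hess: "\<And>x. (f' has_derivative blinfun_apply (f'' x)) (at x)"
    and cont: "isCont f'' xbar"
    and tilt: "tilt_stable_minimizer (\<lambda>x. ereal (f x) + g x) xbar"
  shows "\<exists>\<kappa>. \<forall>w\<in>parallel_span {x. - f' xbar \<in> subdifferential g x}. norm w \<le> \<kappa> * norm (f'' xbar w)"
proof -
  define S where "S = {x. - f' xbar \<in> subdifferential g x}"
  have S: "convex S" "xbar \<in> S"
    using tilt_stable_imp_stationary[OF proper conv grad tilt] convex_subdifferential_inverse[OF conv]
    by (auto simp: S_def)
  obtain \<gamma> U m K where \<gamma>: "\<gamma> > 0" and U: "open U" "0 \<in> U" and lip: "K-lipschitz_on U m"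
    and m: "\<And>v. v \<in> U \<Longrightarrow> tilt_argmin (\<lambda>x. ereal (f x) + g x) xbar \<gamma> v = {m v}"
    using tilt unfolding tilt_stable_minimizer_def by blast
  have K: "K \<ge> 0" using lip by (rule lipschitz_on_nonneg)
  have "isCont f' xbar" using hess by (rule has_derivative_continuous)
  then have "((\<lambda>x. f' x - f' xbar) \<longlongrightarrow> f' xbar - f' xbar) (nhds xbar)"
    unfolding isCont_def tendsto_at_iff_tendsto_nhds by (intro tendsto_intros)
  then have "\<forall>\<^sub>F x in nhds xbar. f' x - f' xbar \<in> U"
    using U by (intro topological_tendstoD) auto
  then obtain \<rho>1 where \<rho>1: "\<rho>1 > 0" "\<And>x. dist x xbar < \<rho>1 \<Longrightarrow> f' x - f' xbar \<in> U"
    by (auto simp: eventually_nhds_metric)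
  \<comment> \<open>The linearization error is small enough to be absorbed by the left-hand side.\<close>
  define e where "e = 1 / (2 * (K + 1))"
  have e: "e > 0" "K * e \<le> 1 / 2" using K by (simp_all add: e_def field_simps)
  obtain \<rho>2 where \<rho>2: "\<rho>2 > 0" and strict: "\<And>x y. x \<in> ball xbar \<rho>2 \<Longrightarrow> y \<in> ball xbar \<rho>2 \<Longrightarrow>
      norm (f' y - f' x - f'' xbar (y - x)) \<le> e * norm (y - x)"
    using strictly_differentiable_bound[OF hess cont e(1)] by blast
  define \<rho> where "\<rho> = min \<gamma> (min \<rho>1 \<rho>2)"
  have \<rho>: "\<rho> > 0" using \<gamma> \<rho>1 \<rho>2 by (simp add: \<rho>_def)
  have bound: "norm (y - x) \<le> 2 * K * norm (f'' xbar (y - x))"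
    if x: "x \<in> S" "x \<in> ball xbar \<rho>" and y: "y \<in> S" "y \<in> ball xbar \<rho>" for x y
  proof -
    have *: "f' u - f' xbar \<in> U" "m (f' u - f' xbar) = u" if u: "u \<in> S" "u \<in> ball xbar \<rho>" for u
    proof -
      show U: "f' u - f' xbar \<in> U" using u by (intro \<rho>1) (simp add: \<rho>_def dist_commute)
      have "u \<in> tilt_argmin (\<lambda>x. ereal (f x) + g x) xbar \<gamma> (f' u - f' xbar)"
        using u by (intro mem_tilt_argmin[OF proper f_conv grad])
          (auto simp: S_def \<rho>_def dist_norm norm_minus_commute)
      then show "m (f' u - f' xbar) = u" using m[OF U] by simp
    qed
    have "norm (y - x) \<le> K * norm (f' y - f' x)"
      using lipschitz_onD[OF lip *(1)[OF y] *(1)[OF x]] *(2)[OF y] *(2)[OF x]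
      by (simp add: dist_norm)
    also have "norm (f' y - f' x) \<le> norm (f'' xbar (y - x)) + e * norm (y - x)"
      using strict[of x y] x y norm_triangle_ineq[of "f'' xbar (y - x)" "f' y - f' x - f'' xbar (y - x)"]
      by (simp add: \<rho>_def)
    also have "K * (norm (f'' xbar (y - x)) + e * norm (y - x))
        = K * norm (f'' xbar (y - x)) + (K * e) * norm (y - x)"
      by (simp add: algebra_simps)
    also have "(K * e) * norm (y - x) \<le> 1 / 2 * norm (y - x)"
      using e by (intro mult_right_mono) auto
    finally show ?thesis using K by (simp add: mult_left_mono)
  qed
  have "norm w \<le> 2 * K * norm (f'' xbar w)" if "w \<in> parallel_span S" for w
  proof -
    obtain u s where u: "u \<in> S" and s: "s > 0" "u + s *\<^sub>R w \<in> S"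
      using convex_parallel_direction[of S w] S \<open>w \<in> parallel_span S\<close> by blast
    \<comment> \<open>\<open>xbar\<close> may lie on the relative boundary of \<open>S\<close>, so \<open>u\<close> and \<open>u + s *\<^sub>R w\<close> are
      contracted towards it inside \<open>S\<close>.\<close>
    define b where "b = norm (u - xbar) + norm (u + s *\<^sub>R w - xbar)"
    define t where "t = min 1 (\<rho> / (b + 1))"
    have b: "b \<ge> 0" by (simp add: b_def)
    have t: "t > 0" "t \<le> 1" using \<rho> b by (simp_all add: t_def)
    have near: "xbar + t *\<^sub>R (p - xbar) \<in> S \<inter> ball xbar \<rho>" if p: "p \<in> S" "norm (p - xbar) \<le> b" for p
    proof -
      have "xbar + t *\<^sub>R (p - xbar) \<in> S"
        using convexD_alt[OF S p(1), of t] t by (simp add: algebra_simps)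
      moreover have "t * norm (p - xbar) < \<rho>"
      proof -
        have "t * norm (p - xbar) \<le> t * b" using p t by (intro mult_left_mono) auto
        also have "\<dots> < t * (b + 1)" using t by simp
        also have "\<dots> \<le> \<rho> / (b + 1) * (b + 1)"
          using b by (intro mult_right_mono) (auto simp: t_def)
        also have "\<dots> = \<rho>" using b by simp
        finally show ?thesis .
      qed
      ultimately show ?thesis using t by (simp add: dist_norm)
    qed
    define x y where "x = xbar + t *\<^sub>R (u - xbar)" and "y = xbar + t *\<^sub>R (u + s *\<^sub>R w - xbar)"
    have "x \<in> S \<inter> ball xbar \<rho>" "y \<in> S \<inter> ball xbar \<rho>"
      unfolding x_def y_def using u s by (intro near; simp add: b_def)+
    moreover have "y - x = (t * s) *\<^sub>R w" by (simp add: x_def y_def algebra_simps)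
    ultimately have "(t * s) * norm w \<le> (t * s) * (2 * K * norm (f'' xbar w))"
      using bound[of x y] t s by (simp add: blinfun.scaleR_right abs_mult mult_ac)
    then show ?thesis using t s by simp
  qed
  then show ?thesis unfolding S_def by blast
qed

section \<open>One step of the method\<close>

text \<open>If both \<open>z\<close> and \<open>v\<close> are subgradients at two points, then \<open>z\<close> and \<open>v\<close> have the same inner product
  with the difference of the points, namely the difference of the values of \<open>g\<close>.\<close>

lemma parallel_span_orthogonal:
  assumes sub: "{x. z \<in> subdifferential g x} \<subseteq> {x. v \<in> subdifferential g x}"
    and w: "w \<in> parallel_span {x. z \<in> subdifferential g x}"
  shows "(z - v) \<bullet> w = 0"
proof -
  have eq: "u \<bullet> (y - x) = real_of_ereal (g y) - real_of_ereal (g x)"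
    if u: "u \<in> subdifferential g x" "u \<in> subdifferential g y" for u x y
  proof -
    obtain r s where "g x = ereal r" "r + u \<bullet> (y - x) \<le> s" "g y = ereal s" "s + u \<bullet> (x - y) \<le> r"
      using u unfolding mem_subdifferential_iff by (metis order_refl)
    then show ?thesis by (simp add: inner_diff_right)
  qed
  have "(z - v) \<bullet> (y - x) = 0" if "z \<in> subdifferential g x" "z \<in> subdifferential g y" for x y
  proof -
    have "v \<in> subdifferential g x" "v \<in> subdifferential g y" using that sub by auto
    then show ?thesis using that eq[of z x y] eq[of v x y] by (simp add: inner_diff_left)
  qed
  then have "parallel_span {x. z \<in> subdifferential g x} \<subseteq> {w. (z - v) \<bullet> w = 0}"
    unfolding parallel_span_def by (intro span_minimal subspace_hyperplane) auto
  then show ?thesis using w by blast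
qed

text \<open>The radii \<open>\<rho>1\<close>, ..., \<open>\<rho>4\<close> control \<open>x\<close> and \<open>y\<close>, and \<open>\<rho>5\<close> controls \<open>z\<close>. The constants \<open>Q\<close> and \<open>P\<close> bound
  \<open>norm (y - xbar)\<close> and \<open>dist z v\<close> by multiples of \<open>norm (x - xbar)\<close>, where \<open>v = - f' xbar\<close>.\<close>

lemma ista_newton_step_quadratic:
  fixes f :: "'a::euclidean_space \<Rightarrow> real"
    and f'' :: "'a \<Rightarrow> 'a \<Rightarrow>\<^sub>L 'a"
  assumes grad: "\<And>x. GDERIV f x :> f' x"
    and hess: "\<And>x. (f' has_derivative blinfun_apply (f'' x)) (at x)"
    and hess_cont: "continuous_on UNIV f''"
    and f_convex: "convex_on UNIV f"
    and g_proper: "proper_fun g"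
    and g_polyhedral: "convex_polyhedral g"
    and tilt: "tilt_stable_minimizer (\<lambda>x. ereal (f x) + g x) xbar"
    and hess_lipschitz: "\<exists>U K. open U \<and> xbar \<in> U \<and> K-lipschitz_on U f''"
    and alpha: "\<alpha> > 0"
  shows "\<exists>\<rho>>0. \<exists>C>0. \<forall>x. norm (x - xbar) \<le> \<rho> \<longrightarrow>
    (\<exists>x'. ista_newton_step \<alpha> f' f'' g x x') \<and>
    (\<forall>x'. ista_newton_step \<alpha> f' f'' g x x' \<longrightarrow> norm (x' - xbar) \<le> C * (norm (x - xbar))\<^sup>2)"
proof -
  define v where "v = - f' xbar"
  have epi: "convex (ereal_epigraph g)" "closed (ereal_epigraph g)"
    using g_polyhedral polyhedron_imp_convex polyhedron_imp_closed
    by (auto simp: convex_polyhedral_def)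
  note conj = subdifferential_fenchel_conjugate[OF g_proper epi]
  have cont: "isCont f'' x" for x
    using hess_cont by (simp add: continuous_on_eq_continuous_at)
  have sym: "f'' x u \<bullet> w = f'' x w \<bullet> u" for x u w
    by (rule hessian_symmetric[OF grad hess cont])
  have v: "v \<in> subdifferential g xbar"
    unfolding v_def by (rule tilt_stable_imp_stationary[OF g_proper epi(1) grad tilt])
  define L where "L = parallel_span {x. v \<in> subdifferential g x}"
  obtain \<kappa> where "\<And>w. w \<in> L \<Longrightarrow> norm w \<le> \<kappa> * norm (f'' xbar w)"
    using tilt_stable_imp_hessian_bound[OF g_proper epi(1) f_convex grad hess cont tilt]
    unfolding L_def v_def by blast
  then obtain c where c: "c > 0" and coercive: "\<And>w. w \<in> L \<Longrightarrow> c * (norm w)\<^sup>2 \<le> f'' xbar w \<bullet> w"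
    using coercive_if_norm_apply_bound[of "f'' xbar" L \<kappa>, OF sym hessian_nonneg[OF f_convex grad hess]]
    by blast

  obtain U K where U: "open U" "xbar \<in> U" and lip: "K-lipschitz_on U f''"
    using hess_lipschitz by blast
  have K: "K \<ge> 0" using lip by (rule lipschitz_on_nonneg)
  obtain \<rho>1 where \<rho>1: "\<rho>1 > 0" "ball xbar \<rho>1 \<subseteq> U"
    using U by (meson open_contains_ball)
  obtain \<rho>2 where \<rho>2: "\<rho>2 > 0" and strict: "\<And>x. x \<in> ball xbar \<rho>2 \<Longrightarrow>
      norm (f' x - f' xbar - f'' xbar (x - xbar)) \<le> 1 * norm (x - xbar)"
    using strictly_differentiable_bound[OF hess cont zero_less_one, of xbar] by (meson centre_in_ball)
  obtain \<rho>3 where \<rho>3: "\<rho>3 > 0" "\<And>y. dist y xbar < \<rho>3 \<Longrightarrow> dist (f'' y) (f'' xbar) < c / 2"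
    using cont[of xbar] c unfolding continuous_at_eps_delta by (meson half_gt_zero)
  obtain \<rho>4 where \<rho>4: "\<rho>4 > 0" "\<And>y. dist y xbar < \<rho>4 \<Longrightarrow> subdifferential g y \<subseteq> subdifferential g xbar"
    using subdifferential_locally_subset[OF g_polyhedral, of xbar] unfolding eventually_nhds_metric by blast
  obtain \<rho>5 where \<rho>5: "\<rho>5 > 0" "\<And>z. dist z v < \<rho>5 \<Longrightarrow>
      {x. z \<in> subdifferential g x} \<subseteq> {x. v \<in> subdifferential g x}"
    using subdifferential_inverse_locally_subset[OF g_polyhedral, of v] unfolding eventually_nhds_metric by blast

  define M where "M = norm (f'' xbar) + 1"
  define Q where "Q = 1 + \<alpha> * M"
  define P where "P = (1 + Q) / \<alpha> + M"
  have M: "M \<ge> 0" by (simp add: M_def)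
  have Q: "Q \<ge> 1" using M alpha by (simp add: Q_def)
  have P: "P > 0" using M Q alpha by (simp add: P_def add_pos_nonneg)
  define r where "r = min (min \<rho>1 \<rho>2) (min \<rho>3 \<rho>4)"
  have r: "r > 0" using \<rho>1 \<rho>2 \<rho>3 \<rho>4 by (simp add: r_def)
  define \<rho> where "\<rho> = min (r / (2 * Q)) (\<rho>5 / (2 * P))"
  have \<rho>: "\<rho> > 0" using r \<rho>5 Q P by (simp add: \<rho>_def)
  have Q\<rho>: "Q * \<rho> < r"
  proof -
    have "Q * \<rho> \<le> Q * (r / (2 * Q))" using Q by (intro mult_left_mono) (auto simp: \<rho>_def)
    also have "\<dots> < r" using Q r by simp
    finally show ?thesis .
  qed
  have P\<rho>: "P * \<rho> < \<rho>5"
  proof -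
    have "P * \<rho> \<le> P * (\<rho>5 / (2 * P))" using P by (intro mult_left_mono) (auto simp: \<rho>_def)
    also have "\<dots> < \<rho>5" using P \<rho>5 by simp
    finally show ?thesis .
  qed
  define C where "C = K * Q\<^sup>2 / (c / 2) + 1"
  have C: "C > 0" using K c by (simp add: C_def add_nonneg_pos)

  have step: "(\<exists>d. is_arg_min (\<lambda>d. 1 / 2 * (f'' y d \<bullet> d) - (z + f' y) \<bullet> d)
          (\<lambda>d. d \<in> parallel_span (subdifferential (fenchel_conjugate g) z)) d) \<and>
      (\<forall>d. is_arg_min (\<lambda>d. 1 / 2 * (f'' y d \<bullet> d) - (z + f' y) \<bullet> d)
          (\<lambda>d. d \<in> parallel_span (subdifferential (fenchel_conjugate g) z)) d \<longrightarrow>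
        norm (y - d - xbar) \<le> C * (norm (x - xbar))\<^sup>2)"
    if x: "norm (x - xbar) \<le> \<rho>" and y: "y \<in> prox \<alpha> g (x - \<alpha> *\<^sub>R f' x)"
      and z: "z = (1 / \<alpha>) *\<^sub>R (x - y) - f' x" for x y z
  proof -
    have "\<rho> \<le> Q * \<rho>" using Q \<rho> by simp
    then have xr: "norm (x - xbar) < r" using x Q\<rho> by linarith
    have fx: "norm (f' x - f' xbar) \<le> M * norm (x - xbar)"
    proof -
      have "norm (f' x - f' xbar) \<le> norm (f'' xbar (x - xbar)) + norm (f' x - f' xbar - f'' xbar (x - xbar))"
        using norm_triangle_ineq[of "f'' xbar (x - xbar)" "f' x - f' xbar - f'' xbar (x - xbar)"] by simp
      also have "\<dots> \<le> norm (f'' xbar) * norm (x - xbar) + 1 * norm (x - xbar)"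
        using xr by (intro add_mono norm_blinfun strict) (simp add: r_def dist_norm norm_minus_commute)
      finally show ?thesis by (simp add: M_def algebra_simps)
    qed
    have z_eq: "z = (1 / \<alpha>) *\<^sub>R ((x - \<alpha> *\<^sub>R f' x) - y)"
      using alpha by (simp add: z algebra_simps)
    have zy: "z \<in> subdifferential g y"
      unfolding z_eq by (rule prox_imp_subdifferential[OF g_proper epi(1) alpha y])
    have "(1 / \<alpha>) *\<^sub>R ((xbar - \<alpha> *\<^sub>R f' xbar) - xbar) \<in> subdifferential g xbar"
      using v alpha by (simp add: v_def)
    from norm_prox_diff_le[OF alpha zy[unfolded z_eq] this]
    have "norm (y - xbar) \<le> norm ((x - xbar) - \<alpha> *\<^sub>R (f' x - f' xbar))"
      by (simp add: algebra_simps)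
    also have "\<dots> \<le> norm (x - xbar) + \<alpha> * norm (f' x - f' xbar)"
      using norm_triangle_ineq4[of "x - xbar" "\<alpha> *\<^sub>R (f' x - f' xbar)"] alpha by simp
    also have "\<dots> \<le> norm (x - xbar) + \<alpha> * (M * norm (x - xbar))"
      using fx alpha by simp
    also have "\<dots> = Q * norm (x - xbar)" by (simp add: Q_def algebra_simps)
    finally have yQ: "norm (y - xbar) \<le> Q * norm (x - xbar)" .
    also have "\<dots> \<le> Q * \<rho>" using x Q by simp
    finally have yr: "dist y xbar < r" using Q\<rho> by (simp add: dist_norm)
    have "dist z v \<le> norm ((1 / \<alpha>) *\<^sub>R ((x - xbar) - (y - xbar))) + norm (f' x - f' xbar)"
      using norm_triangle_ineq4[of "(1 / \<alpha>) *\<^sub>R ((x - xbar) - (y - xbar))" "f' x - f' xbar"]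
      by (simp add: dist_norm z v_def algebra_simps)
    also have "norm ((1 / \<alpha>) *\<^sub>R ((x - xbar) - (y - xbar))) = norm ((x - xbar) - (y - xbar)) / \<alpha>"
      using alpha by simp
    also have "norm ((x - xbar) - (y - xbar)) \<le> norm (x - xbar) + norm (y - xbar)"
      by (rule norm_triangle_ineq4)
    also have "\<dots> \<le> norm (x - xbar) + Q * norm (x - xbar)" using yQ by simp
    also note fx
    also have "(norm (x - xbar) + Q * norm (x - xbar)) / \<alpha> + M * norm (x - xbar) = P * norm (x - xbar)"
      using alpha by (simp add: P_def field_simps)
    also have "\<dots> \<le> P * \<rho>" using x P by simp
    finally have zv: "dist z v < \<rho>5" using P\<rho> alpha by (simp add: divide_right_mono)

    define Lz where "Lz = parallel_span {x. z \<in> subdifferential g x}"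
    have sub: "{x. z \<in> subdifferential g x} \<subseteq> {x. v \<in> subdifferential g x}"
      by (rule \<rho>5(2)[OF zv])
    have Lz: "subspace Lz" by (simp add: Lz_def parallel_span_def)
    have "Lz \<subseteq> L" unfolding Lz_def L_def parallel_span_def using sub by (intro span_mono) blast
    then have coercive_y: "c / 2 * (norm w)\<^sup>2 \<le> f'' y w \<bullet> w" if "w \<in> Lz" for w
    proof -
      have "(f'' xbar - f'' y) w \<bullet> w \<le> norm ((f'' xbar - f'' y) w) * norm w"
        by (rule norm_cauchy_schwarz)
      also have "\<dots> \<le> (norm (f'' xbar - f'' y) * norm w) * norm w"
        by (intro mult_right_mono norm_blinfun) auto
      also have "\<dots> \<le> (c / 2 * norm w) * norm w"
        using \<rho>3(2)[of y] yr
        by (intro mult_right_mono) (auto simp: r_def dist_norm norm_minus_commute)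
      finally have "f'' xbar w \<bullet> w - f'' y w \<bullet> w \<le> c / 2 * (norm w)\<^sup>2"
        by (simp add: blinfun.diff_left inner_diff_left power2_eq_square mult_ac)
      with coercive[of w] \<open>Lz \<subseteq> L\<close> that show ?thesis by auto
    qed
    \<comment> \<open>\<open>z\<close> is a subgradient at \<open>y\<close>, hence at \<open>xbar\<close>.\<close>
    have e: "y - xbar \<in> Lz"
      using zy \<rho>4(2)[of y] yr unfolding Lz_def parallel_span_def
      by (intro span_base) (auto simp: r_def)
    have taylor: "norm (f' y - f' xbar - f'' y (y - xbar)) \<le> K * (norm (y - xbar))\<^sup>2"
      using yr \<rho>1 r
      by (intro hessian_taylor_bound[OF hess lipschitz_on_subset[OF lip \<rho>1(2)]])
         (auto simp: r_def dist_commute)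
    have res: "(f'' y (y - xbar) - (z + f' y)) \<bullet> w \<le> K * (norm (y - xbar))\<^sup>2 * norm w"
      if w: "w \<in> Lz" for w
    proof -
      have "(z - v) \<bullet> w = 0" using parallel_span_orthogonal[OF sub] w by (simp add: Lz_def)
      then have "(f'' y (y - xbar) - (z + f' y)) \<bullet> w
          = (f'' y (y - xbar) - (f' y - f' xbar)) \<bullet> w"
        by (simp add: v_def inner_diff_left inner_add_left)
      also have "\<dots> \<le> norm (f'' y (y - xbar) - (f' y - f' xbar)) * norm w"
        by (rule norm_cauchy_schwarz)
      also have "\<dots> \<le> K * (norm (y - xbar))\<^sup>2 * norm w"
        using taylor by (intro mult_right_mono) (auto simp: norm_minus_commute)
      finally show ?thesis .
    qed
    have "norm (y - d - xbar) \<le> C * (norm (x - xbar))\<^sup>2"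
      if d: "is_arg_min (\<lambda>d. 1 / 2 * (f'' y d \<bullet> d) - (z + f' y) \<bullet> d) (\<lambda>d. d \<in> Lz) d" for d
    proof -
      have "norm ((y - xbar) - d) \<le> K * (norm (y - xbar))\<^sup>2 / (c / 2)"
        using newton_step_error[OF Lz sym _ coercive_y d e _ res] c K by simp
      also have "\<dots> \<le> K * (Q * norm (x - xbar))\<^sup>2 / (c / 2)"
        using yQ K c by (intro divide_right_mono mult_left_mono power_mono) auto
      also have "\<dots> \<le> C * (norm (x - xbar))\<^sup>2"
        by (simp add: C_def power_mult_distrib algebra_simps)
      finally show ?thesis by (simp add: algebra_simps)
    qed
    moreover have "\<exists>d. is_arg_min (\<lambda>d. 1 / 2 * (f'' y d \<bullet> d) - (z + f' y) \<bullet> d) (\<lambda>d. d \<in> Lz) d"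
      using c by (intro quadratic_minimizer_exists[OF Lz _ coercive_y]) auto
    ultimately show ?thesis unfolding conj Lz_def by blast
  qed
  have "(\<exists>x'. ista_newton_step \<alpha> f' f'' g x x') \<and>
    (\<forall>x'. ista_newton_step \<alpha> f' f'' g x x' \<longrightarrow> norm (x' - xbar) \<le> C * (norm (x - xbar))\<^sup>2)"
    if x: "norm (x - xbar) \<le> \<rho>" for x
  proof
    obtain y where y: "y \<in> prox \<alpha> g (x - \<alpha> *\<^sub>R f' x)"
      using prox_nonempty[OF g_proper epi(2) alpha v] by blast
    show "\<exists>x'. ista_newton_step \<alpha> f' f'' g x x'"
      using step[OF x y refl] y unfolding ista_newton_step_def by blast
    show "\<forall>x'. ista_newton_step \<alpha> f' f'' g x x' \<longrightarrow> norm (x' - xbar) \<le> C * (norm (x - xbar))\<^sup>2"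
      using step[OF x] unfolding ista_newton_step_def by blast
  qed
  with \<rho> C show ?thesis by blast
qed

section \<open>Convergence\<close>

lemma quadratic_recursion_convergent:
  fixes x :: "nat \<Rightarrow> 'a::real_normed_vector"
  assumes rec: "\<And>k. norm (x k - xbar) \<le> \<epsilon> \<Longrightarrow> norm (x (Suc k) - xbar) \<le> C * (norm (x k - xbar))\<^sup>2"
    and small: "C * \<epsilon> \<le> 1 / 2" and C: "0 \<le> C" and x0: "norm (x 0 - xbar) \<le> \<epsilon>"
  shows "quadratically_convergent C x xbar"
proof -
  have half: "norm (x (Suc k) - xbar) \<le> 1 / 2 * norm (x k - xbar)" if "norm (x k - xbar) \<le> \<epsilon>" for k
  proof -
    have "norm (x (Suc k) - xbar) \<le> (C * norm (x k - xbar)) * norm (x k - xbar)"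
      using rec[OF that] by (simp add: power2_eq_square mult_ac)
    also have "C * norm (x k - xbar) \<le> C * \<epsilon>" using that C by (rule mult_left_mono)
    also note small
    finally show ?thesis by (simp add: mult_right_mono)
  qed
  have bound: "norm (x k - xbar) \<le> \<epsilon> \<and> norm (x k - xbar) \<le> (1 / 2) ^ k * \<epsilon>" for k
  proof (induction k)
    case (Suc k)
    then have "norm (x (Suc k) - xbar) \<le> 1 / 2 * norm (x k - xbar)" by (intro half) simp
    with Suc norm_ge_zero[of "x k - xbar"] show ?case unfolding power_Suc by linarith
  qed (use x0 in simp)
  have "(\<lambda>k. (1 / 2) ^ k * \<epsilon>) \<longlonglongrightarrow> 0"
    by (intro tendsto_mult_left_zero LIMSEQ_power_zero) simp
  then have "(\<lambda>k. x k - xbar) \<longlonglongrightarrow> 0"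
    by (rule Lim_null_comparison[rotated]) (use bound in simp)
  then have "x \<longlonglongrightarrow> xbar" by (simp add: LIM_zero_iff)
  then show ?thesis using rec bound by (auto simp: quadratically_convergent_def)
qed

theorem corollary3p3:
  fixes f :: "'a::euclidean_space \<Rightarrow> real"
    and f' :: "'a \<Rightarrow> 'a"
    and f'' :: "'a \<Rightarrow> 'a \<Rightarrow>\<^sub>L 'a"
    and g :: "'a \<Rightarrow> ereal"
    and xbar :: 'a
    and \<alpha> :: real
  assumes grad: "\<And>x. GDERIV f x :> f' x"
    and hess: "\<And>x. (f' has_derivative blinfun_apply (f'' x)) (at x)"
    and hess_cont: "continuous_on UNIV f''"
    and f_convex: "convex_on UNIV f"
    and g_proper: "proper_fun g"
    and g_polyhedral: "convex_polyhedral g"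
    and tilt: "tilt_stable_minimizer (\<lambda>x. ereal (f x) + g x) xbar"
    and hess_lipschitz: "\<exists>U K. open U \<and> xbar \<in> U \<and> K-lipschitz_on U f''"
    and alpha: "\<alpha> > 0"
  shows "\<exists>\<epsilon>>0. \<exists>C>0. \<forall>x0. norm (x0 - xbar) \<le> \<epsilon> \<longrightarrow>
           (\<exists>x. ista_newton_sequence \<alpha> f' f'' g x0 x) \<and>
           (\<forall>x. ista_newton_sequence \<alpha> f' f'' g x0 x \<longrightarrow> quadratically_convergent C x xbar)"
proof -
  obtain \<rho> C where \<rho>: "\<rho> > 0" and C: "C > 0"
    and ex: "\<And>x. norm (x - xbar) \<le> \<rho> \<Longrightarrow> \<exists>x'. ista_newton_step \<alpha> f' f'' g x x'"
    and quad: "\<And>x x'. norm (x - xbar) \<le> \<rho> \<Longrightarrow> ista_newton_step \<alpha> f' f'' g x x' \<Longrightarrow>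
      norm (x' - xbar) \<le> C * (norm (x - xbar))\<^sup>2"
    using ista_newton_step_quadratic[OF assms] by blast
  \<comment> \<open>In this ball every step at least halves the distance to \<open>xbar\<close>, so the iterates never leave it.\<close>
  define \<epsilon> where "\<epsilon> = min \<rho> (1 / (2 * C))"
  have \<epsilon>: "\<epsilon> > 0" "\<epsilon> \<le> \<rho>" using \<rho> C by (simp_all add: \<epsilon>_def)
  have "C * \<epsilon> \<le> C * (1 / (2 * C))" using C by (intro mult_left_mono) (auto simp: \<epsilon>_def)
  then have C\<epsilon>: "C * \<epsilon> \<le> 1 / 2" using C by simp
  have stay: "norm (x' - xbar) \<le> \<epsilon>"
    if x: "norm (x - xbar) \<le> \<epsilon>" and x': "ista_newton_step \<alpha> f' f'' g x x'" for x x'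
  proof -
    have "norm (x' - xbar) \<le> C * (norm (x - xbar))\<^sup>2" using quad[OF _ x'] x \<epsilon> by simp
    also have "\<dots> \<le> C * \<epsilon>\<^sup>2" using x C by (intro mult_left_mono power_mono) auto
    also have "\<dots> = (C * \<epsilon>) * \<epsilon>" by (simp add: power2_eq_square)
    also have "\<dots> \<le> 1 / 2 * \<epsilon>" using C\<epsilon> \<epsilon> by (intro mult_right_mono) auto
    finally show ?thesis using \<epsilon> by simp
  qed
  have "(\<exists>x. ista_newton_sequence \<alpha> f' f'' g x0 x) \<and>
      (\<forall>x. ista_newton_sequence \<alpha> f' f'' g x0 x \<longrightarrow> quadratically_convergent C x xbar)"
    if x0: "norm (x0 - xbar) \<le> \<epsilon>" for x0
  proof (intro conjI allI impI)
    have "\<exists>x. \<forall>k. (norm (x k - xbar) \<le> \<epsilon> \<and> (k = 0 \<longrightarrow> x k = x0)) \<and>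
        ista_newton_step \<alpha> f' f'' g (x k) (x (Suc k))"
    proof (rule dependent_nat_choice)
      show "\<exists>x. norm (x - xbar) \<le> \<epsilon> \<and> (0 = (0::nat) \<longrightarrow> x = x0)" using x0 by blast
    next
      fix x k assume "norm (x - xbar) \<le> \<epsilon> \<and> (k = (0::nat) \<longrightarrow> x = x0)"
      then have x: "norm (x - xbar) \<le> \<epsilon>" by blast
      obtain x' where "ista_newton_step \<alpha> f' f'' g x x'" using ex[of x] x \<epsilon> by auto
      with stay[OF x] show "\<exists>x'. (norm (x' - xbar) \<le> \<epsilon> \<and> (Suc k = 0 \<longrightarrow> x' = x0)) \<and>
        ista_newton_step \<alpha> f' f'' g x x'" by blast
    qed
    then show "\<exists>x. ista_newton_sequence \<alpha> f' f'' g x0 x"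
      unfolding ista_newton_sequence_def by blast
  next
    fix x assume seq: "ista_newton_sequence \<alpha> f' f'' g x0 x"
    show "quadratically_convergent C x xbar"
    proof (rule quadratic_recursion_convergent[OF _ C\<epsilon>])
      show "norm (x (Suc k) - xbar) \<le> C * (norm (x k - xbar))\<^sup>2" if "norm (x k - xbar) \<le> \<epsilon>" for k
        using quad[of "x k" "x (Suc k)"] that \<epsilon> seq by (simp add: ista_newton_sequence_def)
    qed (use C x0 seq in \<open>auto simp: ista_newton_sequence_def\<close>)
  qed
  with \<epsilon> C show ?thesis by blast
qed

end
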